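(* There exist universal constants $C>0$ and $c>0$ such that the following holds. For all integers $n,k\ge 1$, every function $f\colon\{0,1\}^n\to\{0,1\}$, every product distribution $\mu$ over $\{0,1\}^n$, every $\epsilon\ge 0$ and every $\delta$ with $0<\delta<n$, $$\mathsf{D}_\epsilon(f^k,\mu^k)\;\ge\; c\cdot\frac{k\delta}{\log(n/\delta)}\cdot\Big(\mathsf{D}_{\epsilon+\delta}(f,\mu)-C\cdot\log(n/\delta)\Big).$$
   Context: Inner products are over $\mathbb{F}_2$: $\langle a,x\rangle=\sum_i a_ix_i \bmod 2$. A deterministic parity decision tree $T$ on $\{0,1\}^N$ is a rooted binary tree in which every internal node is labelled by a vector $a\in\{0,1\}^N$ (the query $\langle a,x\rangle$) and has two children, one for each outcome in $\{0,1\}$, and every leaf is labelled by an output value; $T(x)$ is the label of the leaf reached on input $x$. The depth of $T$ is the maximum number of queries on a root-to-leaf path. For $g\colon\{0,1\}^N\to\{0,1\}^m$ and a probability distribution $\nu$ on $\{0,1\}^N$, $\mathsf{D}_\epsilon(g,\nu)$ is the least depth of a deterministic parity decision tree $T$ with $\Pr_{x\sim\nu}[T(x)\ne g(x)]\le\epsilon$. $f^k\colon(\{0,1\}^n)^k\to\{0,1\}^k$ is $f^k(x^1,\dots,x^k)=(f(x^1),\dots,f(x^k))$, and $\mu^k=\mu\times\cdots\times\mu$ ($k$ times). A distribution on $\{0,1\}^n$ is product if it is a product of $n$ independent Bernoulli distributions. *)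

theory Defs
  imports "HOL-Probability.Probability"
begin

(* {0,1}^N is modelled with an arbitrary finite coordinate set I in place of {1..N}, using False
   as the value outside I.  This makes {0,1}^n the case I = {..<n}, and ({0,1}^n)^k the case
   I = {..<k} \<times> {..<n}, where the pair (j, i) is the i-th bit of the j-th block. *)
definition cube :: "'i set \<Rightarrow> ('i \<Rightarrow> bool) set" where
  "cube I = PiE_dflt I False (\<lambda>_. UNIV)"

definition inner2 :: "'i set \<Rightarrow> ('i \<Rightarrow> bool) \<Rightarrow> ('i \<Rightarrow> bool) \<Rightarrow> bool" where
  "inner2 I a x \<longleftrightarrow> odd (\<Sum>i\<in>I. of_bool (a i) * of_bool (x i) :: nat)"

(* Query a t0 t1 continues with t0 on outcome 0 and with t1 on outcome 1. *)
datatype ('i, 'o) pdt = Leaf 'o | Query "'i \<Rightarrow> bool" "('i, 'o) pdt" "('i, 'o) pdt"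

primrec pdt_on :: "'i set \<Rightarrow> 'o set \<Rightarrow> ('i, 'o) pdt \<Rightarrow> bool" where
  "pdt_on I Y (Leaf y) \<longleftrightarrow> y \<in> Y"
| "pdt_on I Y (Query a t0 t1) \<longleftrightarrow> a \<in> cube I \<and> pdt_on I Y t0 \<and> pdt_on I Y t1"

primrec run :: "'i set \<Rightarrow> ('i, 'o) pdt \<Rightarrow> ('i \<Rightarrow> bool) \<Rightarrow> 'o" where
  "run I (Leaf y) x = y"
| "run I (Query a t0 t1) x = (if inner2 I a x then run I t1 x else run I t0 x)"

primrec depth :: "('i, 'o) pdt \<Rightarrow> nat" where
  "depth (Leaf y) = 0"
| "depth (Query a t0 t1) = Suc (max (depth t0) (depth t1))"

(* D_eps(g, nu) for g : cube I -> Y.  The LEAST is over a nonempty set whenever I is finite,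
   g maps cube I into Y, nu is supported on cube I, and eps is nonnegative. *)
definition pdt_complexity ::
  "'i set \<Rightarrow> 'o set \<Rightarrow> real \<Rightarrow> (('i \<Rightarrow> bool) \<Rightarrow> 'o) \<Rightarrow> ('i \<Rightarrow> bool) pmf \<Rightarrow> nat" where
  "pdt_complexity I Y \<epsilon> g \<nu> =
     (LEAST d. \<exists>T. pdt_on I Y T \<and> depth T = d \<and>
        measure_pmf.prob \<nu> {x. run I T x \<noteq> g x} \<le> \<epsilon>)"

definition product_distribution :: "nat \<Rightarrow> (nat \<Rightarrow> bool) pmf \<Rightarrow> bool" where
  "product_distribution n \<mu> \<longleftrightarrow>
     (\<exists>p. (\<forall>i<n. 0 \<le> p i \<and> p i \<le> 1) \<and>
          \<mu> = Pi_pmf {..<n} False (\<lambda>i. bernoulli_pmf (p i)))"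

definition fun_power :: "nat \<Rightarrow> ((nat \<Rightarrow> bool) \<Rightarrow> bool) \<Rightarrow> (nat \<times> nat \<Rightarrow> bool) \<Rightarrow> (nat \<Rightarrow> bool)" where
  "fun_power k f x = (\<lambda>j. j < k \<and> f (\<lambda>i. x (j, i)))"

definition dist_power :: "nat \<Rightarrow> (nat \<Rightarrow> bool) pmf \<Rightarrow> (nat \<times> nat \<Rightarrow> bool) pmf" where
  "dist_power k \<mu> =
     map_pmf (\<lambda>X (j, i). X j i) (Pi_pmf {..<k} (\<lambda>_. False) (\<lambda>_. \<mu>))"

end

theory Submission
  imports Defs
begin

text \<open>
  A Bernoulli bit is its more likely value, except that it becomes a fair coin (a star) with some
  probability, so a product distribution is a mixture of uniform distributions on subcubes.
  Let a tree \<open>T\<close> on \<open>k\<close> blocks be given, fix the blocks before the last one and compare with the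
  stars of the last block.  A query involving a star is answered by a fair coin, and Gaussian
  elimination removes that star from all later queries.  Hence the last block can be simulated by
  public coins, which removes one query for every star eliminated.  On the other hand, flipping
  only the eliminated stars away from the majority vector already reaches the same leaf.  Writing
  \<open>w\<close> for the least distance from the majority vector to the leaf of the input within one block,
  the expected path length of \<open>T\<close> is therefore at least the sum over all blocks of the expected
  value of \<open>w\<close> in a single-block tree that answers this block as well as \<open>T\<close> does.

  If \<open>w \<le> r\<close> holds up to probability \<open>\<delta> / 2\<close>, then the leaf of the input is one of the at most
  \<open>(n + 1)^r\<close> leaves reached by vectors close to the majority vector.  It can then be found with
  \<open>O(r log n + log (1 / \<delta>))\<close> parity queries by a multiplicative weights search, whatever the depth
  of the tree.
\<close>

subsection \<open>Parity queries and tree transformations\<close>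

primrec path_length :: "'i set \<Rightarrow> ('i, 'o) pdt \<Rightarrow> ('i \<Rightarrow> bool) \<Rightarrow> nat" where
  "path_length I (Leaf y) x = 0"
| "path_length I (Query a t0 t1) x =
     Suc (if inner2 I a x then path_length I t1 x else path_length I t0 x)"

text \<open>Compares the answers along the path rather than the outputs, so leaves with equal labels
  stay distinct and every class is an affine subspace.\<close>

primrec same_leaf :: "'i set \<Rightarrow> ('i, 'o) pdt \<Rightarrow> ('i \<Rightarrow> bool) \<Rightarrow> ('i \<Rightarrow> bool) \<Rightarrow> bool" where
  "same_leaf I (Leaf y) x z \<longleftrightarrow> True"
| "same_leaf I (Query a t0 t1) x z \<longleftrightarrow> inner2 I a x = inner2 I a z \<and>
     (if inner2 I a x then same_leaf I t1 x z else same_leaf I t0 x z)"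

text \<open>Swapping the children where \<open>s a\<close> holds accounts for the affine constant of the rewritten
  query.\<close>

primrec recode :: "(('i \<Rightarrow> bool) \<Rightarrow> 'j \<Rightarrow> bool) \<Rightarrow> (('i \<Rightarrow> bool) \<Rightarrow> bool) \<Rightarrow> ('i, 'o) pdt \<Rightarrow> ('j, 'o) pdt" where
  "recode g s (Leaf y) = Leaf y"
| "recode g s (Query a t0 t1) =
     (if s a then Query (g a) (recode g s t1) (recode g s t0)
      else Query (g a) (recode g s t0) (recode g s t1))"

section \<open>Inner products over the field of two elements and their transport between
  trees\<close>

lemma cube_iff: "x \<in> cube I \<longleftrightarrow> (\<forall>i. i \<notin> I \<longrightarrow> \<not> x i)"
  by (auto simp: cube_def PiE_dflt_def)

lemma finite_cube: "finite I \<Longrightarrow> finite (cube I)"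
  unfolding cube_def by (rule finite_PiE_dflt) auto

lemma card_cube: "finite I \<Longrightarrow> card (cube I) = 2 ^ card I"
  unfolding cube_def by (subst card_PiE_dflt) auto

lemma inner2_insert:
  assumes "finite I" "i \<notin> I"
  shows "inner2 (insert i I) a x \<longleftrightarrow> (a i \<and> x i) \<noteq> inner2 I a x"
  using assms unfolding inner2_def by (subst sum.insert) auto

lemma inner2_cong:
  "(\<And>i. i \<in> I \<Longrightarrow> (a i \<and> x i) = (b i \<and> y i)) \<Longrightarrow> inner2 I a x = inner2 I b y"
  unfolding inner2_def by (intro arg_cong[where f = odd] sum.cong) (auto simp: of_bool_def)

lemma inner2_xor_left:
  assumes "finite I"
  shows "inner2 I (\<lambda>i. a i \<noteq> b i) x \<longleftrightarrow> inner2 I a x \<noteq> inner2 I b x"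
  using assms by (induction I) (auto simp: inner2_insert, auto simp: inner2_def)

text \<open>Coordinate \<open>i\<close> is a pivot of the query: it enters with coefficient one, so
  a suitable value of it forces either answer.\<close>

lemma inner2_update:
  assumes "finite I" "i \<in> I" "a i"
  shows "inner2 I a (x(i := b)) \<longleftrightarrow> inner2 (I - {i}) a x \<noteq> b"
proof -
  have "inner2 I a (x(i := b)) = inner2 (insert i (I - {i})) a (x(i := b))"
    using assms by (simp add: insert_absorb)
  also have "\<dots> \<longleftrightarrow> b \<noteq> inner2 (I - {i}) a (x(i := b))"
    using assms by (subst inner2_insert) auto
  also have "inner2 (I - {i}) a (x(i := b)) = inner2 (I - {i}) a x"
    by (rule inner2_cong) auto
  finally show ?thesis by blast
qed

lemma pdt_on_mono: "pdt_on J Y T \<Longrightarrow> J \<subseteq> I \<Longrightarrow> pdt_on I Y T"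
  by (induction T) (auto simp: cube_iff)

lemma run_in: "pdt_on I Y T \<Longrightarrow> run I T x \<in> Y"
  by (induction T) auto

lemma path_length_le_depth: "path_length I T x \<le> depth T"
  by (induction T) auto

lemma same_leaf_refl [simp]: "same_leaf I T x x"
  by (induction T) auto

lemma same_leaf_trans: "same_leaf I T x y \<Longrightarrow> same_leaf I T y z \<Longrightarrow> same_leaf I T x z"
  by (induction T) (auto split: if_splits)

lemma same_leaf_run: "same_leaf I T x y \<Longrightarrow> run I T x = run I T y"
  by (induction T) (auto split: if_splits)

lemma pdt_on_recode:
  assumes "pdt_on I Y T" "\<And>a. a \<in> cube I \<Longrightarrow> g a \<in> cube J"
  shows "pdt_on J Y (recode g s T)"
  using assms by (induction T) auto

text \<open>One principle for three substitutions: Gaussian elimination of a coordinate, fixing all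
  blocks but the last, and fixing the last block. Only the answers to queries matter, up to the
  constant \<open>s a\<close>, so the inputs and the coordinate sets may both change.\<close>

lemma run_recode:
  assumes "pdt_on I Y T" "\<And>a. a \<in> cube I \<Longrightarrow> inner2 J (g a) v \<longleftrightarrow> inner2 K a x \<noteq> s a"
  shows "run J (recode g s T) v = run K T x"
  using assms by (induction T) auto

lemma path_length_recode:
  assumes "pdt_on I Y T" "\<And>a. a \<in> cube I \<Longrightarrow> inner2 J (g a) v \<longleftrightarrow> inner2 K a x \<noteq> s a"
  shows "path_length J (recode g s T) v = path_length K T x"
  using assms by (induction T) auto

lemma same_leaf_recode:
  assumes "pdt_on I Y T" "\<And>a. a \<in> cube I \<Longrightarrow> inner2 J (g a) v \<longleftrightarrow> inner2 K a x \<noteq> s a"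
    and "\<And>a. a \<in> cube I \<Longrightarrow> inner2 J (g a) v' \<longleftrightarrow> inner2 K a x' \<noteq> s a"
  shows "same_leaf J (recode g s T) v v' \<longleftrightarrow> same_leaf K T x x'"
  using assms by (induction T) auto

lemma same_leaf_cong:
  assumes "pdt_on J Y T" "\<And>i. i \<in> J \<Longrightarrow> x i = y i"
  shows "same_leaf I T x y"
proof -
  have "inner2 I a x = inner2 I a y" if "a \<in> cube J" for a
    using that assms(2) by (intro inner2_cong) (auto simp: cube_iff)
  then show ?thesis using assms(1) by (induction T) auto
qed

lemma same_leaf_path_length: "same_leaf I T x y \<Longrightarrow> path_length I T x = path_length I T y"
  by (induction T) (auto split: if_splits)

text \<open>\<open>P\<close> is a family of trees indexed by public coins that simulates
  \<open>T\<close> when the stars \<open>\<rho>\<close> carry the bits \<open>u\<close>. The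
  injection \<open>\<phi>\<close> turns star bits into coins, so uniform bits become uniform coins.
  The vector \<open>z\<close> shows that flipping some stars of \<open>x\<close> already reaches the
  same leaf, each flip being paid for by a query that the simulation saves.\<close>

definition peels :: "'i set \<Rightarrow> 'i set \<Rightarrow> ('i, 'o) pdt \<Rightarrow> (('i \<Rightarrow> bool) \<Rightarrow> ('i, 'o) pdt) \<Rightarrow>
    ('i \<Rightarrow> bool) \<Rightarrow> (('i \<Rightarrow> bool) \<Rightarrow> 'i \<Rightarrow> bool) \<Rightarrow> bool" where
  "peels I \<rho> T P x \<phi> \<longleftrightarrow> inj_on \<phi> (cube \<rho>) \<and> \<phi> ` cube \<rho> \<subseteq> cube \<rho> \<and>
     (\<forall>u\<in>cube \<rho>. run I (P (\<phi> u)) x = run I T (override_on x u \<rho>) \<and>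
       (\<exists>z. (\<forall>i. i \<notin> \<rho> \<longrightarrow> z i = x i) \<and> same_leaf I T (override_on x u \<rho>) z \<and>
         card {i\<in>\<rho>. z i \<noteq> x i} + path_length I (P (\<phi> u)) x
           \<le> path_length I T (override_on x u \<rho>)))"

text \<open>Induction on the size, not the structure, since the hypothesis is applied to rewritten
  children. \<open>P\<close> is chosen before \<open>x\<close> because a real tree must not depend
  on its unknown input; \<open>\<phi>\<close> serves only the analysis and may depend on
  \<open>x\<close>.\<close>

lemma peel:
  fixes T :: "('i, 'o) pdt"
  assumes "finite I" "J \<subseteq> I" "pdt_on J Y T" "\<rho> \<subseteq> J"
  shows "\<exists>P. (\<forall>u. pdt_on (J - \<rho>) Y (P u)) \<and>
    (\<forall>x. \<exists>\<phi>. peels I \<rho> T P x \<phi>)"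
  using assms(2-)
proof (induction "size T" arbitrary: T J \<rho> rule: less_induct)
  case less
  show ?case
  proof (cases T)
    case (Leaf y)
    have "peels I \<rho> T (\<lambda>_. Leaf y) x id" for x
      unfolding peels_def by (auto simp: Leaf intro!: exI[of _ x])
    then show ?thesis using less.prems Leaf
      by (intro exI[of _ "\<lambda>_. Leaf y"]) auto
  next
    case (Query a t0 t1)
    define t where "t b = (if b then t1 else t0)" for b
    have t: "pdt_on J Y (t b)" "size (t b) < size T" for b
      using less.prems Query by (auto simp: t_def)
    have run_T: "run I T x = run I (t (inner2 I a x)) x"
      and len_T: "path_length I T x = Suc (path_length I (t (inner2 I a x)) x)"
      and same_T: "same_leaf I T x z \<longleftrightarrow>
        inner2 I a x = inner2 I a z \<and> same_leaf I (t (inner2 I a x)) x z" for x z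
      by (auto simp: Query t_def)
    have aJ: "a \<in> cube J" using less.prems Query by simp
    show ?thesis
    proof (cases "\<exists>i\<in>\<rho>. a i")
      \<comment> \<open>No star is involved, so the query is kept. Its answer does not depend on
        \<open>u\<close>, hence only the coin map of the branch taken by \<open>x\<close> is
        needed.\<close>
      case False
      have inner_eq: "inner2 I a y = inner2 I a x" if "\<And>i. i \<notin> \<rho> \<Longrightarrow> y i = x i" for x y
        using that False by (intro inner2_cong) auto
      from less.hyps[OF t(2) less.prems(1) t(1) less.prems(3)]
      obtain P where P: "pdt_on (J - \<rho>) Y (P b u)"
        "\<exists>\<phi>. peels I \<rho> (t b) (P b) x \<phi>"
        for b u x by metis
      show ?thesis
      proof (intro exI[of _ "\<lambda>u. Query a (P False u) (P True u)"] conjI allI)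
        show "pdt_on (J - \<rho>) Y (Query a (P False u) (P True u))" for u
          using P(1) aJ False by (auto simp: cube_iff)
        fix x
        let ?b = "inner2 I a x"
        obtain \<phi> where "peels I \<rho> (t ?b) (P ?b) x \<phi>" using P(2) by blast
        then have \<phi>: "inj_on \<phi> (cube \<rho>)" "\<phi> ` cube \<rho> \<subseteq> cube \<rho>"
          "u \<in> cube \<rho> \<Longrightarrow> run I (P ?b (\<phi> u)) x = run I (t ?b) (override_on x u \<rho>) \<and>
          (\<exists>z. (\<forall>i. i \<notin> \<rho> \<longrightarrow> z i = x i) \<and> same_leaf I (t ?b) (override_on x u \<rho>) z \<and>
          card {i\<in>\<rho>. z i \<noteq> x i} + path_length I (P ?b (\<phi> u)) x \<le> path_length I (t ?b) (override_on x u \<rho>))" for u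
          unfolding peels_def by blast+
        have ov: "inner2 I a (override_on x u \<rho>) = ?b" for u
          by (rule inner_eq) auto
        show "\<exists>\<phi>. peels I \<rho> T (\<lambda>u. Query a (P False u) (P True u)) x \<phi>"
          unfolding peels_def
        proof (intro exI[of _ \<phi>] conjI ballI)
          fix u assume u: "u \<in> cube \<rho>"
          show "run I (Query a (P False (\<phi> u)) (P True (\<phi> u))) x = run I T (override_on x u \<rho>)"
            using \<phi>(3)[OF u] by (cases ?b) (simp_all add: run_T ov)
          obtain z where z: "\<forall>i. i \<notin> \<rho> \<longrightarrow> z i = x i" "same_leaf I (t ?b) (override_on x u \<rho>) z"
            "card {i\<in>\<rho>. z i \<noteq> x i} + path_length I (P ?b (\<phi> u)) x \<le> path_length I (t ?b) (override_on x u \<rho>)"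
            using \<phi>(3)[OF u] by blast
          have "inner2 I a z = ?b" by (rule inner_eq) (use z(1) in auto)
          then show "\<exists>z. (\<forall>i. i \<notin> \<rho> \<longrightarrow> z i = x i) \<and> same_leaf I T (override_on x u \<rho>) z \<and>
            card {i\<in>\<rho>. z i \<noteq> x i} + path_length I (Query a (P False (\<phi> u)) (P True (\<phi> u))) x
            \<le> path_length I T (override_on x u \<rho>)"
            using z by (intro exI[of _ z]) (cases ?b; simp add: same_T len_T ov)
        qed (use \<phi> in auto)
      qed
    next
      case True
      then obtain i where i: "i \<in> \<rho>" "a i" by blast
      define \<rho>' where "\<rho>' = \<rho> - {i}"
      have iI: "i \<in> I" using i less.prems by auto
      \<comment> \<open>Gaussian elimination: on the inputs with \<open>\<langle>a, x\<rangle> = r\<close> the coordinate \<open>i\<close> is removed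
        from all later queries by adding \<open>a\<close> to them.\<close>
      define e where "e r = recode (\<lambda>b. if b i then (\<lambda>l. b l \<noteq> a l) else b) (\<lambda>b. b i \<and> r) (t r)" for r
      have e_on: "pdt_on (J - {i}) Y (e r)" for r
        unfolding e_def by (rule pdt_on_recode[OF t(1)]) (use aJ i in \<open>auto simp: cube_iff\<close>)
      have "size (recode g s T') = size T'" for g :: "('i \<Rightarrow> bool) \<Rightarrow> 'i \<Rightarrow> bool" and s and T' :: "('i, 'o) pdt"
        by (induction T') auto
      then have e_size: "size (e r) < size T" for r
        using t(2) by (simp add: e_def)
      have e_inner: "inner2 I (if b i then (\<lambda>l. b l \<noteq> a l) else b) x \<longleftrightarrow> inner2 I b x \<noteq> (b i \<and> r)"
        if "inner2 I a x = r" for b r x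
        using that inner2_xor_left[OF assms(1), of b a x] by auto
      have e_run: "run I (e r) x = run I (t r) x"
        and e_len: "path_length I (e r) x = path_length I (t r) x" if "inner2 I a x = r" for r x
        unfolding e_def using e_inner[OF that]
        by (auto intro!: run_recode[OF t(1)] path_length_recode[OF t(1)])
      have e_same: "same_leaf I (e r) x z = same_leaf I (t r) x z"
        if "inner2 I a x = r" "inner2 I a z = r" for r x z
        unfolding e_def using e_inner[OF that(1)] e_inner[OF that(2)]
        by (intro same_leaf_recode[OF t(1)]) auto
      have sub: "J - {i} \<subseteq> I" "\<rho>' \<subseteq> J - {i}" using less.prems by (auto simp: \<rho>'_def)
      have J': "J - {i} - \<rho>' = J - \<rho>" using i by (auto simp: \<rho>'_def)
      from less.hyps[OF e_size sub(1) e_on sub(2)]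
      obtain P where P: "pdt_on (J - \<rho>) Y (P b u)"
        "\<exists>\<phi>. peels I \<rho>' (e b) (P b) x \<phi>"
        for b u x unfolding J' by metis
      \<comment> \<open>Coin \<open>i\<close> replaces the answer of the query, so nothing is asked
        at this node; the remaining coins go to the child that the coin selects.\<close>
      show ?thesis
      proof (intro exI[of _ "\<lambda>u. P (u i) (u(i := False))"] conjI allI)
        show "pdt_on (J - \<rho>) Y (P (u i) (u(i := False)))" for u by (rule P(1))
        fix x
        obtain \<psi> where "peels I \<rho>' (e r) (P r) x (\<psi> r)" for r
          using choice[of "\<lambda>r \<psi>. peels I \<rho>' (e r) (P r) x \<psi>"] P(2) by blast
        then have \<psi>: "inj_on (\<psi> r) (cube \<rho>')" "u \<in> cube \<rho>' \<Longrightarrow> \<psi> r u \<in> cube \<rho>'"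
          "u \<in> cube \<rho>' \<Longrightarrow> run I (P r (\<psi> r u)) x = run I (e r) (override_on x u \<rho>')"
          "u \<in> cube \<rho>' \<Longrightarrow> \<exists>z. (\<forall>i. i \<notin> \<rho>' \<longrightarrow> z i = x i) \<and> same_leaf I (e r) (override_on x u \<rho>') z \<and>
             card {i\<in>\<rho>'. z i \<noteq> x i} + path_length I (P r (\<psi> r u)) x
               \<le> path_length I (e r) (override_on x u \<rho>')" for r u
          unfolding peels_def by blast+
        define r where "r u = inner2 I a (override_on x u \<rho>)" for u
        \<comment> \<open>Coin \<open>i\<close> has to equal the true answer \<open>r u\<close>, and
          the other coins are those of the branch selected by it.\<close>
        define \<phi> where "\<phi> u = (\<psi> (r u) (u(i := False)))(i := r u)" for u
        have cube': "u(i := False) \<in> cube \<rho>'" if "u \<in> cube \<rho>" for u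
          using that by (auto simp: cube_iff \<rho>'_def)
        have \<phi>_i: "\<phi> u i = r u" for u by (simp add: \<phi>_def)
        have \<phi>_off: "(\<phi> u)(i := False) = \<psi> (r u) (u(i := False))" if "u \<in> cube \<rho>" for u
        proof -
          have "\<psi> (r u) (u(i := False)) i = False"
            using \<psi>(2)[OF cube'[OF that], of "r u"] by (auto simp: cube_iff \<rho>'_def)
          then show ?thesis by (simp add: \<phi>_def fun_upd_idem_iff)
        qed
        have ov: "override_on x u \<rho> = (override_on x (u(i := False)) \<rho>')(i := u i)" for u
          using i by (auto simp: override_on_def \<rho>'_def fun_eq_iff)
        have r_alt: "r u \<longleftrightarrow> inner2 (I - {i}) a (override_on x (u(i := False)) \<rho>') \<noteq> u i" for u
          unfolding r_def ov using assms(1) iI i(2) by (rule inner2_update)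
        \<comment> \<open>After elimination the child does not read coordinate \<open>i\<close>, so
          it cannot tell \<open>u i\<close> from \<open>x i\<close>.\<close>
        have same_i: "same_leaf I (e b) (override_on x u \<rho>) (override_on x (u(i := False)) \<rho>')" for b u
          by (rule same_leaf_cong[OF e_on]) (auto simp: ov[of u])
        show "\<exists>\<phi>. peels I \<rho> T (\<lambda>u. P (u i) (u(i := False))) x \<phi>"
          unfolding peels_def
        proof (intro exI[of _ \<phi>] conjI ballI)
          show "inj_on \<phi> (cube \<rho>)"
          proof (rule inj_onI)
            fix u v assume uv: "u \<in> cube \<rho>" "v \<in> cube \<rho>" "\<phi> u = \<phi> v"
            \<comment> \<open>Decoding: coin \<open>i\<close> reveals the answer and thus the
              branch, the injection of that branch yields the other stars, and the query then
              determines the star \<open>i\<close>.\<close>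
            have ruv: "r u = r v"
              unfolding \<phi>_i[symmetric] uv(3) ..
            have eq: "\<psi> (r u) (u(i := False)) = \<psi> (r v) (v(i := False))"
              unfolding \<phi>_off[OF uv(1), symmetric] \<phi>_off[OF uv(2), symmetric] uv(3) ..
            have off: "u(i := False) = v(i := False)"
              by (rule inj_onD[OF \<psi>(1) eq[unfolded ruv] cube'[OF uv(1)] cube'[OF uv(2)]])
            have ui: "u i = v i" using ruv r_alt[of u] r_alt[of v] unfolding off by blast
            show "u = v"
            proof (rule ext)
              show "u l = v l" for l using fun_cong[OF off, of l] ui by (cases "l = i") auto
            qed
          qed
          show "\<phi> ` cube \<rho> \<subseteq> cube \<rho>"
          proof (rule image_subsetI)
            fix u assume "u \<in> cube \<rho>"
            then have "\<psi> (r u) (u(i := False)) \<in> cube \<rho>'" by (intro \<psi>(2) cube')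
            then show "\<phi> u \<in> cube \<rho>" using i by (auto simp: \<phi>_def cube_iff \<rho>'_def)
          qed
          fix u assume u: "u \<in> cube \<rho>"
          show "run I (P (\<phi> u i) ((\<phi> u)(i := False))) x = run I T (override_on x u \<rho>)"
            unfolding \<phi>_i \<phi>_off[OF u] \<psi>(3)[OF cube'[OF u]]
            using same_leaf_run[OF same_i[of "r u" u]] e_run[of "override_on x u \<rho>" "r u"]
            by (simp add: run_T r_def)
          obtain z where z: "\<forall>i. i \<notin> \<rho>' \<longrightarrow> z i = x i"
            "same_leaf I (e (r u)) (override_on x (u(i := False)) \<rho>') z"
            "card {i\<in>\<rho>'. z i \<noteq> x i} + path_length I (P (r u) (\<psi> (r u) (u(i := False)))) x
              \<le> path_length I (e (r u)) (override_on x (u(i := False)) \<rho>')"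
            using \<psi>(4)[OF cube'[OF u], of "r u"] by blast
          \<comment> \<open>The pivot is set so that \<open>z'\<close> answers the removed query
            like the true input. The child does not notice, and the one extra flip is paid for by
            the one saved query.\<close>
          define z' where "z' = z(i := (inner2 (I - {i}) a z \<noteq> r u))"
          have az': "inner2 I a z' = r u"
            unfolding z'_def using inner2_update[of I i a, OF assms(1) iI i(2)] by auto
          have "same_leaf I (e (r u)) z z'"
            by (rule same_leaf_cong[OF e_on]) (auto simp: z'_def)
          then have "same_leaf I (e (r u)) (override_on x u \<rho>) z'"
            by (intro same_leaf_trans[OF same_i same_leaf_trans[OF z(2)]])
          then have same: "same_leaf I T (override_on x u \<rho>) z'"
            using az' e_same[of "override_on x u \<rho>" "r u" z'] by (simp add: same_T r_def)
          have fin: "finite \<rho>" using less.prems assms(1) by (meson finite_subset)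
          have "card {l\<in>\<rho>. z' l \<noteq> x l} \<le> card (insert i {l\<in>\<rho>'. z l \<noteq> x l})"
            by (rule card_mono) (use fin in \<open>auto simp: \<rho>'_def z'_def\<close>)
          also have "\<dots> \<le> Suc (card {l\<in>\<rho>'. z l \<noteq> x l})"
            by (rule card_insert_le_m1[THEN order_trans]) (use fin in \<open>auto simp: \<rho>'_def\<close>)
          finally have "card {l\<in>\<rho>. z' l \<noteq> x l} \<le> Suc (card {l\<in>\<rho>'. z l \<noteq> x l})" .
          moreover have "path_length I T (override_on x u \<rho>) =
              Suc (path_length I (e (r u)) (override_on x (u(i := False)) \<rho>'))"
            using same_leaf_path_length[OF same_i[of "r u" u]] e_len[of "override_on x u \<rho>" "r u"]
            by (simp add: len_T r_def)
          moreover have "\<forall>l. l \<notin> \<rho> \<longrightarrow> z' l = x l"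
            using z(1) i by (auto simp: z'_def \<rho>'_def)
          ultimately show "\<exists>z. (\<forall>i. i \<notin> \<rho> \<longrightarrow> z i = x i) \<and> same_leaf I T (override_on x u \<rho>) z \<and>
            card {i\<in>\<rho>. z i \<noteq> x i} + path_length I (P (\<phi> u i) ((\<phi> u)(i := False))) x
            \<le> path_length I T (override_on x u \<rho>)"
            unfolding \<phi>_i \<phi>_off[OF u] using same z(3) by (intro exI[of _ z']) simp
        qed
      qed
    qed
  qed
qed

subsection \<open>Product distributions as mixtures of subcubes\<close>

text \<open>The Hamming distance from \<open>m\<close> to the whole affine subspace of inputs
  sharing the leaf of \<open>x\<close>; with \<open>m\<close> the majority vector it is the quantity
  \<open>w\<close> of the outline.\<close>

definition leaf_dist :: "'i set \<Rightarrow> ('i, 'o) pdt \<Rightarrow> ('i \<Rightarrow> bool) \<Rightarrow> ('i \<Rightarrow> bool) \<Rightarrow> nat" where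
  "leaf_dist I T m x = (LEAST d. \<exists>z\<in>cube I. same_leaf I T x z \<and> card {i\<in>I. z i \<noteq> m i} = d)"

lemma sum_cube_insert:
  fixes h :: "_ \<Rightarrow> real"
  assumes "finite \<rho>" "i \<notin> \<rho>"
  shows "(\<Sum>u\<in>cube (insert i \<rho>). h u) = (\<Sum>u\<in>cube \<rho>. h (u(i := True)) + h (u(i := False)))"
proof -
  have eq: "cube (insert i \<rho>) = (\<lambda>u. u(i := True)) ` cube \<rho> \<union> (\<lambda>u. u(i := False)) ` cube \<rho>"
  proof (intro equalityI subsetI)
    fix u assume u: "u \<in> cube (insert i \<rho>)"
    have "u = (u(i := False))(i := u i)" by simp
    moreover have "u(i := False) \<in> cube \<rho>" using u by (auto simp: cube_iff)
    ultimately have "u \<in> (\<lambda>v. v(i := u i)) ` cube \<rho>" by (rule image_eqI)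
    then show "u \<in> (\<lambda>u. u(i := True)) ` cube \<rho> \<union> (\<lambda>u. u(i := False)) ` cube \<rho>"
      by (cases "u i") simp_all
  qed (auto simp: cube_iff)
  have inj: "inj_on (\<lambda>u. u(i := b)) (cube \<rho>)" for b
  proof (rule inj_onI)
    fix u v assume "u \<in> cube \<rho>" "v \<in> cube \<rho>" "u(i := b) = v(i := b)"
    then show "u = v" using assms(2) by (auto simp: cube_iff fun_eq_iff split: if_splits)
  qed
  have "(\<lambda>u. u(i := True)) ` cube \<rho> \<inter> (\<lambda>u. u(i := False)) ` cube \<rho> = {}"
    by (auto dest: fun_cong[of _ _ i])
  then show ?thesis
    unfolding eq using assms(1) by (simp add: sum.union_disjoint finite_cube sum.reindex inj sum.distrib)
qed

lemma set_Pi_pmf_cube: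
  assumes "finite I"
  shows "set_pmf (Pi_pmf I False p) \<subseteq> cube I"
  using set_Pi_pmf_subset[OF assms, of False p] by (auto simp: cube_iff)

lemma expectation_Pi_pmf_insert:
  fixes G :: "_ \<Rightarrow> real"
  assumes "finite B" "i \<notin> B" "0 \<le> p i" "p i \<le> 1"
  shows "measure_pmf.expectation (Pi_pmf (insert i B) False (\<lambda>i. bernoulli_pmf (p i))) G =
    p i * measure_pmf.expectation (Pi_pmf B False (\<lambda>i. bernoulli_pmf (p i))) (\<lambda>x. G (x(i := True))) +
    (1 - p i) * measure_pmf.expectation (Pi_pmf B False (\<lambda>i. bernoulli_pmf (p i))) (\<lambda>x. G (x(i := False)))"
proof -
  have fin: "finite (set_pmf (Pi_pmf B False (\<lambda>i. bernoulli_pmf (p i))))"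
    using finite_subset[OF set_Pi_pmf_cube finite_cube] assms(1) by blast
  have eq: "Pi_pmf (insert i B) False (\<lambda>i. bernoulli_pmf (p i)) =
    bernoulli_pmf (p i) \<bind> (\<lambda>b. map_pmf (\<lambda>x. x(i := b)) (Pi_pmf B False (\<lambda>i. bernoulli_pmf (p i))))"
    using Pi_pmf_insert'[OF assms(1,2), of False "\<lambda>i. bernoulli_pmf (p i)"]
    by (simp add: map_pmf_def)
  show ?thesis
    unfolding eq using assms fin
    by (subst pmf_expectation_bind[of UNIV]) (auto simp: UNIV_bool)
qed

text \<open>A biased bit is a fixed majority value with probability \<open>1 - 2 q\<close> and a fair coin with
  probability \<open>2 q\<close>, where \<open>q\<close> is the smaller of the two probabilities.\<close>

lemma bernoulli_product_mixture:
  assumes "finite B" "\<forall>i\<in>B. 0 \<le> p i \<and> p i \<le> 1"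
  shows "\<exists>m\<in>cube B. \<exists>\<Lambda>. (\<forall>\<rho>. 0 \<le> \<Lambda> \<rho>) \<and> (\<Sum>\<rho>\<in>Pow B. \<Lambda> \<rho>) = (1::real) \<and>
    (\<forall>G::_ \<Rightarrow> real. measure_pmf.expectation (Pi_pmf B False (\<lambda>i. bernoulli_pmf (p i))) G =
      (\<Sum>\<rho>\<in>Pow B. \<Lambda> \<rho> * ((\<Sum>u\<in>cube \<rho>. G (override_on m u \<rho>)) / 2 ^ card \<rho>)))"
  using assms
proof (induction B)
  case empty
  have "cube {} = {\<lambda>_. False}" by (auto simp: cube_iff)
  then show ?case
    by (intro bexI[of _ "\<lambda>_. False"] exI[of _ "\<lambda>_. 1"]) auto
next
  case (insert i B)
  let ?E = "measure_pmf.expectation (Pi_pmf B False (\<lambda>i. bernoulli_pmf (p i)))"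
  obtain m \<Lambda> where IH: "m \<in> cube B" "\<And>\<rho>. 0 \<le> \<Lambda> \<rho>" "(\<Sum>\<rho>\<in>Pow B. \<Lambda> \<rho>) = 1"
    "\<And>G::_ \<Rightarrow> real. ?E G =
      (\<Sum>\<rho>\<in>Pow B. \<Lambda> \<rho> * ((\<Sum>u\<in>cube \<rho>. G (override_on m u \<rho>)) / 2 ^ card \<rho>))"
    using insert by auto
  have p: "0 \<le> p i" "p i \<le> 1" using insert.prems by auto
  define b where "b \<longleftrightarrow> p i > 1 / 2"
  define q where "q = min (p i) (1 - p i)"
  define m' where "m' = m(i := b)"
  \<comment> \<open>\<open>\<Lambda> \<rho>\<close> is the probability that exactly the coordinates
    in \<open>\<rho>\<close> become stars; the new coordinate is a star independently with
    probability \<open>2 * q\<close>.\<close>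
  define \<Lambda>' where "\<Lambda>' \<rho> = (if i \<in> \<rho> then 2 * q * \<Lambda> (\<rho> - {i}) else (1 - 2 * q) * \<Lambda> \<rho>)" for \<rho>
  have split: "(\<Sum>\<rho>\<in>Pow (insert i B). h \<rho>) = (\<Sum>\<rho>\<in>Pow B. h \<rho>) + (\<Sum>\<rho>\<in>Pow B. h (insert i \<rho>))"
    for h :: "_ \<Rightarrow> real"
  proof -
    have "inj_on (insert i) (Pow B)" using insert.hyps by (auto simp: inj_on_def)
    moreover have "Pow B \<inter> insert i ` Pow B = {}" using insert.hyps by auto
    ultimately show ?thesis
      unfolding Pow_insert using insert.hyps by (simp add: sum.union_disjoint sum.reindex)
  qed
  have \<Lambda>1: "\<Lambda>' \<rho> = (1 - 2 * q) * \<Lambda> \<rho>" and \<Lambda>2: "\<Lambda>' (insert i \<rho>) = 2 * q * \<Lambda> \<rho>"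
    if "\<rho> \<in> Pow B" for \<rho>
  proof -
    have "i \<notin> \<rho>" using that insert.hyps by auto
    then show "\<Lambda>' \<rho> = (1 - 2 * q) * \<Lambda> \<rho>" "\<Lambda>' (insert i \<rho>) = 2 * q * \<Lambda> \<rho>"
      by (simp_all add: \<Lambda>'_def)
  qed
  show ?case
  proof (intro bexI[of _ m'] exI[of _ \<Lambda>'] conjI allI)
    show "0 \<le> \<Lambda>' \<rho>" for \<rho>
    proof -
      have "0 \<le> q" "0 \<le> 1 - 2 * q" using p by (auto simp: q_def min_def)
      then show ?thesis using IH(2) by (simp add: \<Lambda>'_def)
    qed
    show "(\<Sum>\<rho>\<in>Pow (insert i B). \<Lambda>' \<rho>) = 1"
      unfolding split using IH(3) by (simp add: \<Lambda>1 \<Lambda>2 sum_distrib_left[symmetric])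
    show "m' \<in> cube (insert i B)" using IH(1) by (auto simp: m'_def cube_iff)
    fix G :: "_ \<Rightarrow> real"
    have *: "\<Lambda>' \<rho> * ((\<Sum>u\<in>cube \<rho>. G (override_on m' u \<rho>)) / 2 ^ card \<rho>) =
        (1 - 2 * q) * (\<Lambda> \<rho> * ((\<Sum>u\<in>cube \<rho>. G ((override_on m u \<rho>)(i := b))) / 2 ^ card \<rho>))"
      if "\<rho> \<in> Pow B" for \<rho>
    proof -
      have "override_on m' u \<rho> = (override_on m u \<rho>)(i := b)" for u
        using that insert.hyps by (auto simp: override_on_def m'_def fun_eq_iff)
      then show ?thesis using \<Lambda>1[OF that] by simp
    qed
    have **: "\<Lambda>' (insert i \<rho>) * ((\<Sum>u\<in>cube (insert i \<rho>). G (override_on m' u (insert i \<rho>))) / 2 ^ card (insert i \<rho>)) =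
        q * (\<Lambda> \<rho> * ((\<Sum>u\<in>cube \<rho>. G ((override_on m u \<rho>)(i := True))) / 2 ^ card \<rho>)) +
        q * (\<Lambda> \<rho> * ((\<Sum>u\<in>cube \<rho>. G ((override_on m u \<rho>)(i := False))) / 2 ^ card \<rho>))"
      if "\<rho> \<in> Pow B" for \<rho>
    proof -
      have \<rho>: "finite \<rho>" "i \<notin> \<rho>" using that insert.hyps finite_subset by auto
      have "override_on m' (u(i := c)) (insert i \<rho>) = (override_on m u \<rho>)(i := c)" for u c
        using \<rho> by (auto simp: override_on_def m'_def fun_eq_iff)
      then show ?thesis
        unfolding sum_cube_insert[OF \<rho>] \<Lambda>2[OF that] using \<rho>
        by (simp add: sum.distrib field_simps)
    qed
    have "(\<Sum>\<rho>\<in>Pow (insert i B). \<Lambda>' \<rho> * ((\<Sum>u\<in>cube \<rho>. G (override_on m' u \<rho>)) / 2 ^ card \<rho>)) =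
        (1 - 2 * q) * ?E (\<lambda>x. G (x(i := b))) + (q * ?E (\<lambda>x. G (x(i := True))) + q * ?E (\<lambda>x. G (x(i := False))))"
      unfolding split using * ** by (simp add: IH(4) sum.distrib sum_distrib_left)
    also have "\<dots> = p i * ?E (\<lambda>x. G (x(i := True))) + (1 - p i) * ?E (\<lambda>x. G (x(i := False)))"
    proof (cases b)
      case True
      then have pq: "p i = 1 - q" by (simp add: b_def q_def)
      have "(1 - 2 * q) * s + (q * s + q * t) = p i * s + (1 - p i) * t" for s t
        unfolding pq by (simp add: algebra_simps)
      then show ?thesis using True by simp
    next
      case False
      then have "q = p i" by (simp add: b_def q_def)
      then have "(1 - 2 * q) * t + (q * s + q * t) = p i * s + (1 - p i) * t" for s t
        by (simp add: algebra_simps)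
      then show ?thesis using False by simp
    qed
    also have "\<dots> = measure_pmf.expectation (Pi_pmf (insert i B) False (\<lambda>i. bernoulli_pmf (p i))) G"
      using insert.hyps p by (rule expectation_Pi_pmf_insert[symmetric])
    finally show "measure_pmf.expectation (Pi_pmf (insert i B) False (\<lambda>i. bernoulli_pmf (p i))) G =
      (\<Sum>\<rho>\<in>Pow (insert i B). \<Lambda>' \<rho> * ((\<Sum>u\<in>cube \<rho>. G (override_on m' u \<rho>)) / 2 ^ card \<rho>))" ..
  qed
qed

subsection \<open>Peeling off blocks\<close>

definition glue :: "nat \<Rightarrow> (nat \<times> nat \<Rightarrow> bool) \<Rightarrow> (nat \<Rightarrow> bool) \<Rightarrow> nat \<times> nat \<Rightarrow> bool" where
  "glue j X y = (\<lambda>(a, l). if a = j then y l else X (a, l))"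

lemma glue_simps [simp]: "glue j X y (j, l) = y l" "a \<noteq> j \<Longrightarrow> glue j X y (a, l) = X (a, l)"
  by (simp_all add: glue_def)

lemma finite_set_dist_power:
  assumes "finite (set_pmf \<mu>)"
  shows "finite (set_pmf (dist_power j \<mu>))"
  unfolding dist_power_def using assms by (auto simp: set_Pi_pmf intro!: finite_imageI)

lemma expectation_dist_power_Suc:
  fixes F :: "_ \<Rightarrow> real"
  assumes "finite (set_pmf \<mu>)"
  shows "measure_pmf.expectation (dist_power (Suc j) \<mu>) F =
    measure_pmf.expectation (dist_power j \<mu>) (\<lambda>X. measure_pmf.expectation \<mu> (\<lambda>y. F (glue j X y)))"
proof -
  let ?P = "Pi_pmf {..<j} (\<lambda>_. False) (\<lambda>_. \<mu>)"
  let ?u = "\<lambda>X (j, i). X j i"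
  have "?u (X(j := y)) = glue j (?u X) y" for X :: "nat \<Rightarrow> nat \<Rightarrow> bool" and y
    by (auto simp: glue_def)
  then have "dist_power (Suc j) \<mu> = map_pmf (\<lambda>(y, X). glue j (?u X) y) (pair_pmf \<mu> ?P)"
    unfolding dist_power_def lessThan_Suc
    by (subst Pi_pmf_insert) (auto simp: pmf.map_comp o_def case_prod_beta')
  also have "\<dots> = dist_power j \<mu> \<bind> (\<lambda>X. map_pmf (glue j X) \<mu>)"
    unfolding dist_power_def
    by (subst pair_commute_pmf)
      (simp add: pair_pmf_def map_pmf_def bind_assoc_pmf bind_return_pmf)
  finally have "measure_pmf.expectation (dist_power (Suc j) \<mu>) F =
      (\<Sum>X\<in>set_pmf (dist_power j \<mu>). pmf (dist_power j \<mu>) X *\<^sub>R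
        measure_pmf.expectation (map_pmf (glue j X) \<mu>) F)"
    using pmf_expectation_bind[of "set_pmf (dist_power j \<mu>)" "\<lambda>X. map_pmf (glue j X) \<mu>" "dist_power j \<mu>" F]
      finite_set_dist_power[OF assms, of j] assms by simp
  also have "\<dots> = measure_pmf.expectation (dist_power j \<mu>)
      (\<lambda>X. measure_pmf.expectation (map_pmf (glue j X) \<mu>) F)"
    using finite_set_dist_power[OF assms, of j] by (intro integral_measure_pmf[symmetric])
  finally show ?thesis by simp
qed

section \<open>Queries, leaves and subcubes of inputs glued from blocks\<close>

lemma run_map_pdt: "run I (map_pdt g T) x = g (run I T x)"
  by (induction T) auto

lemma pdt_on_map_pdt: "pdt_on I Y T \<Longrightarrow> pdt_on I (g ` Y) (map_pdt g T)"
  by (induction T) auto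

lemma same_leaf_map_pdt: "same_leaf I (map_pdt g T) x z = same_leaf I T x z"
  by (induction T) auto

lemma inner2_Un:
  assumes "finite A" "finite B" "A \<inter> B = {}"
  shows "inner2 (A \<union> B) a x \<longleftrightarrow> inner2 A a x \<noteq> inner2 B a x"
  using assms unfolding inner2_def by (subst sum.union_disjoint) auto

text \<open>Once either side of the split is fixed, the query becomes an affine query in the other
  side, whose constant \<open>recode\<close> absorbs.\<close>

lemma inner2_glue:
  "inner2 ({..<Suc j} \<times> {..<n}) a (glue j X y) \<longleftrightarrow>
    inner2 ({..<j} \<times> {..<n}) a X \<noteq> inner2 {..<n} (\<lambda>l. a (j, l)) y"
proof -
  have "{..<Suc j} \<times> {..<n} = {..<j} \<times> {..<n} \<union> Pair j ` {..<n}" by auto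
  then have "inner2 ({..<Suc j} \<times> {..<n}) a (glue j X y) \<longleftrightarrow>
      inner2 ({..<j} \<times> {..<n}) a (glue j X y) \<noteq> inner2 (Pair j ` {..<n}) a (glue j X y)"
    by (simp only:) (rule inner2_Un; auto)
  also have "inner2 ({..<j} \<times> {..<n}) a (glue j X y) = inner2 ({..<j} \<times> {..<n}) a X"
    by (rule inner2_cong) auto
  also have "inner2 (Pair j ` {..<n}) a (glue j X y) = inner2 {..<n} (\<lambda>l. a (j, l)) y"
    unfolding inner2_def by (subst sum.reindex) (auto simp: inj_on_def)
  finally show ?thesis .
qed

lemma glue_override_on:
  "override_on (glue j X m) u (Pair j ` \<rho>) = glue j X (override_on m (\<lambda>l. u (j, l)) \<rho>)"
  by (auto simp: override_on_def glue_def fun_eq_iff)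

lemma sum_cube_Pair:
  fixes h :: "_ \<Rightarrow> real"
  shows "(\<Sum>u\<in>cube (Pair j ` \<rho>). h (\<lambda>l. u (j, l))) = (\<Sum>u\<in>cube \<rho>. h u)"
  by (rule sum.reindex_bij_witness[of _ "\<lambda>u (a, l). a = j \<and> u l" "\<lambda>u l. u (j, l)"])
    (auto simp: cube_iff fun_eq_iff)

lemma leaf_dist_le:
  assumes "z \<in> cube I" "same_leaf I T x z"
  shows "leaf_dist I T m x \<le> card {i\<in>I. z i \<noteq> m i}"
  unfolding leaf_dist_def using assms by (intro Least_le) auto

text \<open>Peeling off the last block: a tree on \<open>j + 1\<close> blocks becomes a single-block tree once the
  first \<open>j\<close> blocks are fixed, and a tree on \<open>j\<close> blocks once the free coordinates of the last block
  are turned into public coins.\<close>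

lemma potential_lower_bound:
  fixes f :: "(nat \<Rightarrow> bool) \<Rightarrow> bool" and T :: "(nat \<times> nat, nat \<Rightarrow> bool) pdt" and \<beta> r :: real
  assumes fin: "finite (set_pmf \<mu>)" and m: "m \<in> cube {..<n}"
    and \<Lambda>: "\<And>\<rho>. 0 \<le> \<Lambda> \<rho>" "(\<Sum>\<rho>\<in>Pow {..<n}. \<Lambda> \<rho>) = (1::real)"
    and mix: "\<And>G::_ \<Rightarrow> real. measure_pmf.expectation \<mu> G =
      (\<Sum>\<rho>\<in>Pow {..<n}. \<Lambda> \<rho> * ((\<Sum>u\<in>cube \<rho>. G (override_on m u \<rho>)) / 2 ^ card \<rho>))"
    and r: "0 < r"
    and single: "\<And>S :: (nat, bool) pdt. pdt_on {..<n} UNIV S \<Longrightarrow>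
      \<beta> \<le> measure_pmf.expectation \<mu>
        (\<lambda>y. of_bool (run {..<n} S y \<noteq> f y) + real (leaf_dist {..<n} S m y) / r)"
    and T: "pdt_on ({..<j} \<times> {..<n}) UNIV T"
  shows "real j * \<beta> \<le> measure_pmf.expectation (dist_power j \<mu>)
    (\<lambda>x. (\<Sum>i<j. of_bool (run ({..<j} \<times> {..<n}) T x i \<noteq> f (\<lambda>l. x (i, l)))) +
      real (path_length ({..<j} \<times> {..<n}) T x) / r)"
  using T
proof (induction j arbitrary: T)
  case 0
  then show ?case using r by (auto intro!: Bochner_Integration.integral_nonneg)
next
  case (Suc j)
  define I where "I = {..<j} \<times> {..<n}"
  define I' where "I' = {..<Suc j} \<times> {..<n}"
  \<comment> \<open>The potential of a tree on \<open>j\<close> blocks: one unit per wrong output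
    bit and \<open>1 / r\<close> per query.\<close>
  define \<Psi> where "\<Psi> T X = (\<Sum>i<j. of_bool (run I T X i \<noteq> f (\<lambda>l. X (i, l)))) +
    real (path_length I T X) / r" for T X
  have T': "pdt_on I' UNIV T" using Suc.prems by (simp add: I'_def)
  have fin_I': "finite I'" by (simp add: I'_def)
  have pair_sub: "Pair j ` \<rho> \<subseteq> I'" if "\<rho> \<in> Pow {..<n}" for \<rho>
    using that by (auto simp: I'_def)
  have I'_I: "(a, l) \<in> I'" if "(a, l) \<in> I" for a l using that by (auto simp: I_def I'_def)

  \<comment> \<open>The tree for block \<open>j\<close> alone: the first blocks are fixed to
    \<open>X\<close>, which makes their share of each query a constant, and only output bit
    \<open>j\<close> is kept.\<close>
  define S where "S X = map_pdt (\<lambda>y. y j) (recode (\<lambda>a l. a (j, l)) (\<lambda>a. inner2 I a X) T)" for X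
  have glue_inner: "inner2 {..<n} (\<lambda>l. a (j, l)) y \<longleftrightarrow> inner2 I' a (glue j X y) \<noteq> inner2 I a X"
    for a X y
    unfolding I'_def I_def inner2_glue by blast
  have S_on: "pdt_on {..<n} UNIV (S X)" for X
  proof -
    have "pdt_on {..<n} UNIV (recode (\<lambda>a l. a (j, l)) (\<lambda>a. inner2 I a X) T)"
      by (rule pdt_on_recode[OF T']) (auto simp: cube_iff I'_def)
    then have "pdt_on {..<n} (range (\<lambda>y. y j)) (S X)"
      unfolding S_def by (rule pdt_on_map_pdt)
    moreover have "range (\<lambda>y :: nat \<Rightarrow> bool. y j) = UNIV"
      by (rule surjI[of _ "\<lambda>b _. b"]) simp
    ultimately show ?thesis by simp
  qed
  have S_run: "run {..<n} (S X) y = run I' T (glue j X y) j" for X y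
    unfolding S_def run_map_pdt using run_recode[OF T' glue_inner] by simp
  have S_same: "same_leaf {..<n} (S X) y z = same_leaf I' T (glue j X y) (glue j X z)" for X y z
    unfolding S_def same_leaf_map_pdt by (rule same_leaf_recode[OF T' glue_inner glue_inner])

  have "\<forall>\<rho>. \<exists>P. \<rho> \<in> Pow {..<n} \<longrightarrow> (\<forall>u. pdt_on (I' - Pair j ` \<rho>) UNIV (P u)) \<and>
      (\<forall>x. \<exists>\<phi>. peels I' (Pair j ` \<rho>) T P x \<phi>)"
  proof
    fix \<rho>
    show "\<exists>P. \<rho> \<in> Pow {..<n} \<longrightarrow> (\<forall>u. pdt_on (I' - Pair j ` \<rho>) UNIV (P u)) \<and>
      (\<forall>x. \<exists>\<phi>. peels I' (Pair j ` \<rho>) T P x \<phi>)"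
    proof (cases "\<rho> \<in> Pow {..<n}")
      case True
      then show ?thesis using peel[OF fin_I' order.refl T' pair_sub[OF True]] by simp
    qed simp
  qed
  from choice[OF this] obtain P where P: "\<forall>\<rho>. \<rho> \<in> Pow {..<n} \<longrightarrow>
      (\<forall>u. pdt_on (I' - Pair j ` \<rho>) UNIV (P \<rho> u)) \<and> (\<forall>x. \<exists>\<phi>. peels I' (Pair j ` \<rho>) T (P \<rho>) x \<phi>)"
    by (elim exE)
  have P_on: "pdt_on (I' - Pair j ` \<rho>) UNIV (P \<rho> u)"
    and P_peels: "\<exists>\<phi>. peels I' (Pair j ` \<rho>) T (P \<rho>) x \<phi>" if "\<rho> \<in> Pow {..<n}" for \<rho> u x
    using P that by simp_all
  \<comment> \<open>After peeling, block \<open>j\<close> is read only outside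
    \<open>\<rho>\<close>, where it equals \<open>m\<close>. Its share of a query is therefore a
    known constant, and a tree on the first \<open>j\<close> blocks remains.\<close>
  define Q where "Q \<rho> u = recode (\<lambda>a l. a l \<and> l \<in> I) (\<lambda>a. inner2 {..<n} (\<lambda>l. a (j, l)) m) (P \<rho> u)"
    for \<rho> u
  have Q_inner: "inner2 I (\<lambda>l. a l \<and> l \<in> I) X \<longleftrightarrow>
      inner2 I' a (glue j X m) \<noteq> inner2 {..<n} (\<lambda>l. a (j, l)) m" for a X
  proof -
    have "inner2 I (\<lambda>l. a l \<and> l \<in> I) X = inner2 I a X" by (rule inner2_cong) auto
    then show ?thesis using glue_inner[of a m X] by auto
  qed
  have P_on': "pdt_on I' UNIV (P \<rho> u)" if "\<rho> \<in> Pow {..<n}" for \<rho> u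
    by (rule pdt_on_mono[OF P_on[OF that]]) auto
  have Q_on: "pdt_on I UNIV (Q \<rho> u)" if "\<rho> \<in> Pow {..<n}" for \<rho> u
    unfolding Q_def by (rule pdt_on_recode[OF P_on'[OF that]]) (auto simp: cube_iff)
  have Q_run: "run I (Q \<rho> u) X = run I' (P \<rho> u) (glue j X m)"
    and Q_len: "path_length I (Q \<rho> u) X = path_length I' (P \<rho> u) (glue j X m)"
    if "\<rho> \<in> Pow {..<n}" for \<rho> u X
    unfolding Q_def
    using run_recode[OF P_on'[OF that] Q_inner] path_length_recode[OF P_on'[OF that] Q_inner] by auto

  \<comment> \<open>The potential of \<open>T\<close> on \<open>j + 1\<close> blocks minus the share
    of block \<open>j\<close>, namely its error and its leaf distance divided by \<open>r\<close>.
    This bounds what the peeled trees on \<open>j\<close> blocks cost.\<close>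
  define G where "G X y = (\<Sum>i<j. of_bool (run I' T (glue j X y) i \<noteq> f (\<lambda>l. X (i, l)))) +
    (real (path_length I' T (glue j X y)) - real (leaf_dist {..<n} (S X) m y)) / r" for X y
  have step: "(\<Sum>u\<in>cube (Pair j ` \<rho>). \<Psi> (Q \<rho> u) X) \<le> (\<Sum>u\<in>cube \<rho>. G X (override_on m u \<rho>))"
    if \<rho>: "\<rho> \<in> Pow {..<n}" for \<rho> X
  proof -
    obtain \<phi> where "peels I' (Pair j ` \<rho>) T (P \<rho>) (glue j X m) \<phi>"
      using P_peels[OF \<rho>] by blast
    note \<phi> = this[unfolded peels_def, THEN conjunct1] this[unfolded peels_def, THEN conjunct2, THEN conjunct1]
      this[unfolded peels_def, THEN conjunct2, THEN conjunct2]
    have fin_\<rho>: "finite \<rho>" using \<rho> finite_subset by auto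
    \<comment> \<open>An injection of a finite set into itself is a bijection, so summing over coins
      is the same as summing over star values.\<close>
    have "bij_betw \<phi> (cube (Pair j ` \<rho>)) (cube (Pair j ` \<rho>))"
      using endo_inj_surj[OF finite_cube \<phi>(2,1)] \<phi>(1) fin_\<rho> unfolding bij_betw_def by simp
    then have "(\<Sum>u\<in>cube (Pair j ` \<rho>). \<Psi> (Q \<rho> u) X) = (\<Sum>u\<in>cube (Pair j ` \<rho>). \<Psi> (Q \<rho> (\<phi> u)) X)"
      by (rule sum.reindex_bij_betw[symmetric])
    also have "\<dots> \<le> (\<Sum>u\<in>cube (Pair j ` \<rho>). G X (override_on m (\<lambda>l. u (j, l)) \<rho>))"
    proof (rule sum_mono)
      fix u assume u: "u \<in> cube (Pair j ` \<rho>)"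
      let ?y = "override_on m (\<lambda>l. u (j, l)) \<rho>"
      obtain z where z: "\<And>i. i \<notin> Pair j ` \<rho> \<Longrightarrow> z i = glue j X m i"
        "same_leaf I' T (glue j X ?y) z"
        "card {i \<in> Pair j ` \<rho>. z i \<noteq> glue j X m i} + path_length I' (P \<rho> (\<phi> u)) (glue j X m)
          \<le> path_length I' T (glue j X ?y)"
        using bspec[OF \<phi>(3) u, unfolded glue_override_on] by blast
      have run_eq: "run I' (P \<rho> (\<phi> u)) (glue j X m) = run I' T (glue j X ?y)"
        using bspec[OF \<phi>(3) u, unfolded glue_override_on] by blast
      let ?z = "\<lambda>l. z (j, l)"
      have z_glue: "z = glue j X ?z"
      proof (rule ext)
        show "z i = glue j X ?z i" for i
          using z(1)[of i] by (cases i; cases "fst i = j") auto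
      qed
      have z_off: "?z l = m l" if "l \<notin> \<rho>" for l using z(1)[of "(j, l)"] that by auto
      \<comment> \<open>The block of \<open>z\<close> lies in the leaf of \<open>?y\<close> and
        differs from \<open>m\<close> only in flipped stars, so the flips counted by
        \<open>peels\<close> bound the leaf distance.\<close>
      have "leaf_dist {..<n} (S X) m ?y \<le> card {l\<in>{..<n}. ?z l \<noteq> m l}"
      proof (rule leaf_dist_le)
        show "?z \<in> cube {..<n}" using z_off \<rho> m by (auto simp: cube_iff)
        show "same_leaf {..<n} (S X) ?y ?z" unfolding S_same using z(2) z_glue by simp
      qed
      also have "\<dots> = card (Pair j ` {l\<in>{..<n}. ?z l \<noteq> m l})"
        by (rule card_image[symmetric]) (auto simp: inj_on_def)
      also have "\<dots> \<le> card {i \<in> Pair j ` \<rho>. z i \<noteq> glue j X m i}"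
        using fin_\<rho> z_off by (intro card_mono) auto
      finally have "real (path_length I' (P \<rho> (\<phi> u)) (glue j X m)) \<le>
          real (path_length I' T (glue j X ?y)) - real (leaf_dist {..<n} (S X) m ?y)"
        using z(3) by linarith
      then show "\<Psi> (Q \<rho> (\<phi> u)) X \<le> G X ?y"
        unfolding \<Psi>_def G_def Q_run[OF \<rho>] Q_len[OF \<rho>] run_eq
        using r by (intro add_mono order.refl divide_right_mono) auto
    qed
    also have "\<dots> = (\<Sum>u\<in>cube \<rho>. G X (override_on m u \<rho>))" by (rule sum_cube_Pair)
    finally show ?thesis .
  qed

  let ?D = "dist_power j \<mu>"
  have fin_D: "finite (set_pmf ?D)" by (rule finite_set_dist_power[OF fin])
  note int = integrable_measure_pmf_finite[OF fin] integrable_measure_pmf_finite[OF fin_D]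
  have IH: "real j * \<beta> \<le> measure_pmf.expectation ?D (\<Psi> (Q \<rho> u))" if "\<rho> \<in> Pow {..<n}" for \<rho> u
    using Suc.IH[of "Q \<rho> u"] Q_on[OF that] unfolding \<Psi>_def I_def by simp
  \<comment> \<open>The constant is written as an average over star sets and coins, so that the
    induction hypothesis applies to each tree \<open>Q \<rho> u\<close> separately.\<close>
  have "real j * \<beta> = (\<Sum>\<rho>\<in>Pow {..<n}. \<Lambda> \<rho> * ((\<Sum>u\<in>cube (Pair j ` \<rho>). real j * \<beta>) / 2 ^ card \<rho>))"
  proof -
    have "(\<Sum>u\<in>cube (Pair j ` \<rho>). real j * \<beta>) / 2 ^ card \<rho> = real j * \<beta>" if "\<rho> \<in> Pow {..<n}" for \<rho>
    proof -
      have "finite (Pair j ` \<rho>)" using that finite_subset by auto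
      moreover have "card (Pair j ` \<rho>) = card \<rho>" by (rule card_image) (auto simp: inj_on_def)
      ultimately show ?thesis by (simp add: card_cube)
    qed
    then show ?thesis using \<Lambda>(2) by (simp add: sum_distrib_right[symmetric])
  qed
  also have "\<dots> \<le> (\<Sum>\<rho>\<in>Pow {..<n}. \<Lambda> \<rho> *
      ((\<Sum>u\<in>cube (Pair j ` \<rho>). measure_pmf.expectation ?D (\<Psi> (Q \<rho> u))) / 2 ^ card \<rho>))"
    using IH by (intro sum_mono mult_left_mono divide_right_mono \<Lambda>(1)) auto
  also have "\<dots> = measure_pmf.expectation ?D (\<lambda>X. \<Sum>\<rho>\<in>Pow {..<n}. \<Lambda> \<rho> *
      ((\<Sum>u\<in>cube (Pair j ` \<rho>). \<Psi> (Q \<rho> u) X) / 2 ^ card \<rho>))"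
    by (simp add: int)
  also have "\<dots> \<le> measure_pmf.expectation ?D (\<lambda>X. measure_pmf.expectation \<mu> (G X))"
    unfolding mix using step
    by (intro integral_mono int sum_mono mult_left_mono divide_right_mono \<Lambda>(1)) auto
  finally have G_bound: "real j * \<beta> \<le> measure_pmf.expectation ?D (\<lambda>X. measure_pmf.expectation \<mu> (G X))" .

  \<comment> \<open>For every fixed \<open>X\<close> the single-block hypothesis contributes
    \<open>\<beta>\<close>, and the terms subtracted in \<open>G\<close> are exactly those it
    bounds.\<close>
  have split: "measure_pmf.expectation \<mu> (\<lambda>y.
      (\<Sum>i<Suc j. of_bool (run I' T (glue j X y) i \<noteq> f (\<lambda>l. glue j X y (i, l)))) +
      real (path_length I' T (glue j X y)) / r) \<ge> \<beta> + measure_pmf.expectation \<mu> (G X)" for X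
  proof -
    have "\<beta> + measure_pmf.expectation \<mu> (G X) \<le> measure_pmf.expectation \<mu>
        (\<lambda>y. of_bool (run {..<n} (S X) y \<noteq> f y) + real (leaf_dist {..<n} (S X) m y) / r) +
        measure_pmf.expectation \<mu> (G X)"
      using single[OF S_on] by simp
    also have "\<dots> = measure_pmf.expectation \<mu>
        (\<lambda>y. (of_bool (run {..<n} (S X) y \<noteq> f y) + real (leaf_dist {..<n} (S X) m y) / r) + G X y)"
      by (rule Bochner_Integration.integral_add[symmetric]) (rule int)+
    also have "\<dots> = measure_pmf.expectation \<mu> (\<lambda>y.
      (\<Sum>i<Suc j. of_bool (run I' T (glue j X y) i \<noteq> f (\<lambda>l. glue j X y (i, l)))) +
      real (path_length I' T (glue j X y)) / r)"
      by (rule Bochner_Integration.integral_cong) (auto simp: G_def S_run diff_divide_distrib)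
    finally show ?thesis .
  qed
  have "real (Suc j) * \<beta> \<le> measure_pmf.expectation ?D (\<lambda>X. \<beta> + measure_pmf.expectation \<mu> (G X))"
    using G_bound by (simp add: int algebra_simps)
  also have "\<dots> \<le> measure_pmf.expectation ?D (\<lambda>X. measure_pmf.expectation \<mu> (\<lambda>y.
      (\<Sum>i<Suc j. of_bool (run I' T (glue j X y) i \<noteq> f (\<lambda>l. glue j X y (i, l)))) +
      real (path_length I' T (glue j X y)) / r))"
    using split by (intro integral_mono int) auto
  finally show ?case
    unfolding expectation_dist_power_Suc[OF fin] I'_def .
qed

subsection \<open>Searching for a leaf by multiplicative weights\<close>

definition satisfies :: "'i set \<Rightarrow> (('i \<Rightarrow> bool) \<times> bool) set \<Rightarrow> ('i \<Rightarrow> bool) \<Rightarrow> bool" where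
  "satisfies I C x \<longleftrightarrow> (\<forall>c\<in>C. inner2 I (fst c) x = snd c)"

definition leaf_weight :: "'i set \<Rightarrow> ('i, 'o) pdt \<Rightarrow> ('i \<Rightarrow> bool) set \<Rightarrow> (('i \<Rightarrow> bool) \<Rightarrow> real) \<Rightarrow>
    ('i \<Rightarrow> bool) \<Rightarrow> real" where
  "leaf_weight I T Z w x = sum w {z\<in>Z. same_leaf I T x z}"

text \<open>With \<open>p\<close> the share of the weight on the leaf of \<open>x\<close>, this is
  \<open>sqrt ((1 - p) / p)\<close>. It is at least one when \<open>p\<close> is at most a half, so
  it dominates the error of guessing the heaviest leaf. Without the root, equal gains and losses
  would cancel on average; concavity turns them into progress.\<close>

definition uncertainty :: "'i set \<Rightarrow> ('i, 'o) pdt \<Rightarrow> ('i \<Rightarrow> bool) set \<Rightarrow> (('i \<Rightarrow> bool) \<Rightarrow> real) \<Rightarrow>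
    ('i \<Rightarrow> bool) \<Rightarrow> real" where
  "uncertainty I T Z w x = sqrt ((sum w Z - leaf_weight I T Z w x) / leaf_weight I T Z w x)"

text \<open>While the weight exceeds \<open>2 * \<theta>\<close>, some child has more than
  \<open>\<theta>\<close> of it. Descending to such a child ends at a node of weight between
  \<open>\<theta>\<close> and \<open>2 * \<theta>\<close> or at a leaf; \<open>C\<close> collects
  the answers on the way.\<close>

lemma heavy_node:
  assumes "finite Z" "\<And>z. z \<in> Z \<Longrightarrow> (0::real) \<le> w z" "pdt_on I Y T" "0 \<le> \<theta>" "2 * \<theta> < sum w Z"
  shows "\<exists>C. finite C \<and> fst ` C \<subseteq> cube I \<and>
    (\<forall>x y. same_leaf I T x y \<longrightarrow> satisfies I C x = satisfies I C y) \<and>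
    \<theta> \<le> sum w {z\<in>Z. satisfies I C z} \<and>
    (sum w {z\<in>Z. satisfies I C z} \<le> 2 * \<theta> \<or>
     (\<forall>x y. satisfies I C x \<longrightarrow> satisfies I C y \<longrightarrow> same_leaf I T x y))"
  using assms
proof (induction T arbitrary: Z)
  case (Leaf y)
  then show ?case
    by (intro exI[of _ "{}"]) (auto simp: satisfies_def)
next
  case (Query a t0 t1)
  define t where "t b = (if b then t1 else t0)" for b
  define Zb where "Zb b = {z\<in>Z. inner2 I a z = b}" for b
  have same_T: "same_leaf I (Query a t0 t1) x z \<longleftrightarrow>
      inner2 I a x = inner2 I a z \<and> same_leaf I (t (inner2 I a x)) x z" for x z
    by (auto simp: t_def)
  have "sum w Z = sum w (Zb True \<union> Zb False)"
    by (rule arg_cong[where f = "sum w"]) (auto simp: Zb_def)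
  also have "\<dots> = sum w (Zb True) + sum w (Zb False)"
    using Query.prems(1) by (intro sum.union_disjoint) (auto simp: Zb_def)
  finally have "\<theta> < sum w (Zb True) \<or> \<theta> < sum w (Zb False)"
    using Query.prems(5) by linarith
  then obtain b where b: "\<theta> < sum w (Zb b)" by blast
  show ?case
  proof (cases "sum w (Zb b) \<le> 2 * \<theta>")
    case True
    then show ?thesis using b Query.prems
      by (intro exI[of _ "{(a, b)}"]) (auto simp: satisfies_def Zb_def)
  next
    case False
    have "\<exists>C. finite C \<and> fst ` C \<subseteq> cube I \<and>
      (\<forall>x y. same_leaf I (t b) x y \<longrightarrow> satisfies I C x = satisfies I C y) \<and>
      \<theta> \<le> sum w {z\<in>Zb b. satisfies I C z} \<and>
      (sum w {z\<in>Zb b. satisfies I C z} \<le> 2 * \<theta> \<or>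
       (\<forall>x y. satisfies I C x \<longrightarrow> satisfies I C y \<longrightarrow> same_leaf I (t b) x y))"
      unfolding t_def using Query.prems False
      by (cases b; simp only: if_True if_False; intro Query.IH) (auto simp: Zb_def)
    then obtain C where C: "finite C" "fst ` C \<subseteq> cube I"
      "\<And>x y. same_leaf I (t b) x y \<Longrightarrow> satisfies I C x = satisfies I C y"
      "\<theta> \<le> sum w {z\<in>Zb b. satisfies I C z}"
      "sum w {z\<in>Zb b. satisfies I C z} \<le> 2 * \<theta> \<or>
       (\<forall>x y. satisfies I C x \<longrightarrow> satisfies I C y \<longrightarrow> same_leaf I (t b) x y)"
      by blast
    have sat: "satisfies I (insert (a, b) C) x \<longleftrightarrow> inner2 I a x = b \<and> satisfies I C x" for x
      by (auto simp: satisfies_def)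
    have Z: "{z\<in>Z. satisfies I (insert (a, b) C) z} = {z\<in>Zb b. satisfies I C z}"
      by (auto simp: sat Zb_def)
    show ?thesis
    proof (intro exI[of _ "insert (a, b) C"] conjI allI impI)
      show "satisfies I (insert (a, b) C) x = satisfies I (insert (a, b) C) y"
        if "same_leaf I (Query a t0 t1) x y" for x y
        using that C(3)[of x y] unfolding same_T sat by auto
      show "sum w {z \<in> Z. satisfies I (insert (a, b) C) z} \<le> 2 * \<theta> \<or>
        (\<forall>x y. satisfies I (insert (a, b) C) x \<longrightarrow> satisfies I (insert (a, b) C) y \<longrightarrow>
          same_leaf I (Query a t0 t1) x y)"
        unfolding Z unfolding same_T sat using C(5) by auto
    qed (use C(1,2,4) Query.prems(3) in \<open>auto simp: Z\<close>)
  qed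
qed

text \<open>Affine constraints can be added over the field of two elements: the sum is again one
  parity query, and it fails exactly when an odd number of the summands fail.\<close>

lemma parity_combination:
  assumes "finite I" "finite S" "fst ` S \<subseteq> cube I"
  shows "\<exists>a\<in>cube I. \<exists>b. \<forall>x. inner2 I a x = b \<longleftrightarrow> even (card {c\<in>S. inner2 I (fst c) x \<noteq> snd c})"
  using assms(2,3)
proof (induction S)
  case empty
  show ?case
    by (intro bexI[of _ "\<lambda>_. False"] exI[of _ False]) (auto simp: inner2_def cube_iff)
next
  case (insert d S)
  then obtain a b where ab: "a \<in> cube I"
    "\<And>x. inner2 I a x = b \<longleftrightarrow> even (card {c\<in>S. inner2 I (fst c) x \<noteq> snd c})" by auto
  have card: "card {c\<in>insert d S. inner2 I (fst c) x \<noteq> snd c} =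
      card {c\<in>S. inner2 I (fst c) x \<noteq> snd c} + (if inner2 I (fst d) x \<noteq> snd d then 1 else 0)" for x
  proof -
    have "{c\<in>insert d S. inner2 I (fst c) x \<noteq> snd c} = (if inner2 I (fst d) x \<noteq> snd d
        then insert d {c\<in>S. inner2 I (fst c) x \<noteq> snd c} else {c\<in>S. inner2 I (fst c) x \<noteq> snd c})"
      by auto
    then show ?thesis using insert.hyps by simp
  qed
  show ?case
    unfolding card
  proof (intro bexI[of _ "\<lambda>i. a i \<noteq> fst d i"] exI[of _ "b \<noteq> snd d"] allI)
    show "inner2 I (\<lambda>i. a i \<noteq> fst d i) x = (b \<noteq> snd d) \<longleftrightarrow>
      even (card {c\<in>S. inner2 I (fst c) x \<noteq> snd c} + (if inner2 I (fst d) x \<noteq> snd d then 1 else 0))" for x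
      using ab(2)[of x] inner2_xor_left[OF assms(1), of a "fst d" x] by auto
    show "(\<lambda>i. a i \<noteq> fst d i) \<in> cube I" using insert.prems ab(1) by (auto simp: cube_iff)
  qed
qed

text \<open>Toggling \<open>v\<close> is an involution on the subsets that flips the parity. Hence a
  random combination of constraints is a fair coin for an input that violates at least one of
  them.\<close>

lemma sum_Pow_parity:
  fixes p q :: real
  assumes "finite C" "v \<in> C" "v \<in> V"
  shows "(\<Sum>S\<in>Pow C. if even (card (S \<inter> V)) then p else q) = 2 ^ card C * ((p + q) / 2)"
proof -
  let ?h = "\<lambda>S. if even (card (S \<inter> V)) then p else q"
  define t where "t S = (if v \<in> S then S - {v} else insert v S)" for S
  have t: "t (t S) = S" "S \<in> Pow C \<Longrightarrow> t S \<in> Pow C" for S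
    using assms by (auto simp: t_def)
  have flip: "even (card (t S \<inter> V)) \<longleftrightarrow> odd (card (S \<inter> V))" if "S \<in> Pow C" for S
  proof (cases "v \<in> S")
    case True
    have "finite (S \<inter> V)" using that assms finite_subset by fastforce
    moreover have "S \<inter> V = insert v ((S - {v}) \<inter> V)" using True assms by auto
    ultimately have "card (S \<inter> V) = Suc (card ((S - {v}) \<inter> V))"
      by (metis (no_types, lifting) card_insert_disjoint Diff_iff IntD1 finite_insert insertI1)
    then show ?thesis using True by (simp add: t_def)
  next
    case False
    have "finite (S \<inter> V)" using that assms finite_subset by fastforce
    then show ?thesis using False assms by (simp add: t_def)
  qed
  have "sum ?h (Pow C) = (\<Sum>S\<in>Pow C. ?h (t S))"
    by (rule sum.reindex_bij_witness[of _ t t]) (use t in auto)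
  then have "2 * sum ?h (Pow C) = (\<Sum>S\<in>Pow C. ?h S + ?h (t S))"
    by (simp add: sum.distrib)
  also have "\<dots> = (\<Sum>S\<in>Pow C. p + q)"
    by (rule sum.cong) (use flip in auto)
  finally show ?thesis using assms by (simp add: card_Pow)
qed

text \<open>The square of the sum of roots is \<open>2 * p + 2 * sqrt (p^2 - v^2)\<close>, and
  \<open>v \<ge> p / 3\<close> bounds the inner root by \<open>0.96 * p\<close>. The factor
  \<open>99 / 100\<close> comes from \<open>2 + 1.92 \<le> 1.98^2\<close>.\<close>

lemma sqrt_average_bound:
  fixes p v :: real
  assumes "0 \<le> p" "p / 3 \<le> v" "v \<le> p"
  shows "(sqrt (p + v) + sqrt (p - v)) / 2 \<le> 99 / 100 * sqrt p"
proof -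
  have "p\<^sup>2 / 9 \<le> v\<^sup>2"
    using power_mono[of "p / 3" v 2] assms by (simp add: power_divide)
  then have "(p + v) * (p - v) \<le> (96 / 100 * p)\<^sup>2"
    by (simp add: algebra_simps power2_eq_square) (use zero_le_square[of p] in linarith)
  then have "sqrt (p + v) * sqrt (p - v) \<le> 96 / 100 * p"
    unfolding real_sqrt_mult[symmetric] using assms by (intro real_le_lsqrt) auto
  moreover have "(sqrt (p + v) + sqrt (p - v))\<^sup>2 = 2 * p + 2 * (sqrt (p + v) * sqrt (p - v))"
    using assms by (simp add: power2_sum)
  moreover have "(2 * (99 / 100 * sqrt p))\<^sup>2 = 9801 / 2500 * p"
    using assms by (simp add: power_mult_distrib power_divide)
  ultimately have "(sqrt (p + v) + sqrt (p - v))\<^sup>2 \<le> (2 * (99 / 100 * sqrt p))\<^sup>2"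
    using assms by simp
  then have "sqrt (p + v) + sqrt (p - v) \<le> 2 * (99 / 100 * sqrt p)"
    by (rule power2_le_imp_le) (use assms in auto)
  then show ?thesis by simp
qed

lemma leaf_weight_le:
  assumes "finite Z" "\<And>z. z \<in> Z \<Longrightarrow> 0 \<le> w z"
  shows "leaf_weight I T Z w x \<le> sum w Z"
  unfolding leaf_weight_def using assms by (intro sum_mono2) auto

lemma leaf_weight_add_le:
  assumes "finite Z" "\<And>z. z \<in> Z \<Longrightarrow> 0 \<le> w z" "\<And>z. z \<in> Z \<Longrightarrow> same_leaf I T x z \<Longrightarrow> \<not> Q z"
  shows "leaf_weight I T Z w x + sum w {z\<in>Z. Q z} \<le> sum w Z"
proof -
  have "leaf_weight I T Z w x + sum w {z\<in>Z. Q z} = sum w ({z\<in>Z. same_leaf I T x z} \<union> {z\<in>Z. Q z})"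
    unfolding leaf_weight_def using assms by (intro sum.union_disjoint[symmetric]) auto
  also have "\<dots> \<le> sum w Z" using assms by (intro sum_mono2) auto
  finally show ?thesis .
qed

text \<open>For an input at the heavy node, halving the weight outside turns the total
  \<open>W\<close> into \<open>(W + V) / 2\<close> and keeps the leaf weight \<open>l\<close>.
  Either a third of \<open>W\<close> lies outside the node, or the node is the leaf itself and the
  excess \<open>W - l\<close> is halved.\<close>

lemma uncertainty_step_inside:
  assumes "0 < l" "l \<le> W" "V \<le> 2 * W / 3 \<or> V = (l::real)"
  shows "sqrt (((W + V) / 2 - l) / l) \<le> 99 / 100 * sqrt ((W - l) / l)"
proof -
  have "(W + V) / 2 - l \<le> (99 / 100)\<^sup>2 * (W - l)"
    using assms by (auto simp: power2_eq_square)
  then have "((W + V) / 2 - l) / l \<le> (99 / 100)\<^sup>2 * ((W - l) / l)"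
    using assms(1) divide_right_mono[of _ _ l] by fastforce
  then have "sqrt (((W + V) / 2 - l) / l) \<le> sqrt ((99 / 100)\<^sup>2 * ((W - l) / l))"
    by (rule real_sqrt_le_mono)
  also have "\<dots> = 99 / 100 * sqrt ((W - l) / l)"
    unfolding real_sqrt_mult real_sqrt_abs by simp
  finally show ?thesis .
qed

text \<open>A multiplicative weights search: each round asks a random combination of the constraints
  that lead to a node carrying a constant fraction of the current weight.  Inputs reaching the node
  always pass this test and the others pass it with probability one half.\<close>

lemma leaf_search:
  fixes q :: "('i \<Rightarrow> bool) \<Rightarrow> real"
  assumes "finite I" "finite Z" "pdt_on I Y T"
  assumes "finite X" "\<And>z. z \<in> Z \<Longrightarrow> 0 \<le> w z" "\<And>x. x \<in> X \<Longrightarrow> 0 \<le> q x"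
    "\<And>x. x \<in> X \<Longrightarrow> 0 < leaf_weight I T Z w x"
  shows "\<exists>T'. pdt_on I Y T' \<and> depth T' \<le> R \<and>
    (\<Sum>x\<in>X. q x * of_bool (run I T' x \<noteq> run I T x)) \<le>
      (99 / 100) ^ R * (\<Sum>x\<in>X. q x * uncertainty I T Z w x)"
  using assms(4-)
proof (induction R arbitrary: w X)
  case 0
  show ?case
  proof (cases "X = {}")
    case True
    then show ?thesis using run_in[OF assms(3)] by (intro exI[of _ "Leaf (run I T undefined)"]) auto
  next
    case False
    then have "Max (leaf_weight I T Z w ` X) \<in> leaf_weight I T Z w ` X"
      using 0 by (intro Max_in) auto
    then obtain x0 where x0: "x0 \<in> X" "leaf_weight I T Z w x0 = Max (leaf_weight I T Z w ` X)"
      by auto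
    have "q x * of_bool (run I T x0 \<noteq> run I T x) \<le> q x * uncertainty I T Z w x" if "x \<in> X" for x
    proof (cases "run I T x0 = run I T x")
      case True
      then show ?thesis
        using 0 that leaf_weight_le[OF assms(2) 0(2), where I = I and T = T and x = x] by (auto simp: uncertainty_def less_imp_le)
    next
      case False
      have "leaf_weight I T Z w x + leaf_weight I T Z w x0 \<le> sum w Z"
        unfolding leaf_weight_def[of _ _ _ _ x0]
      proof (rule leaf_weight_add_le[OF assms(2) 0(2)])
        show "\<not> same_leaf I T x0 z" if "same_leaf I T x z" for z
          using False same_leaf_run that by metis
      qed auto
      moreover have "leaf_weight I T Z w x \<le> leaf_weight I T Z w x0"
        unfolding x0(2) using 0(1) that by (intro Max_ge) auto
      ultimately have "1 \<le> (sum w Z - leaf_weight I T Z w x) / leaf_weight I T Z w x"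
        using 0(4)[OF that] by (subst pos_le_divide_eq) auto
      then have "1 \<le> uncertainty I T Z w x" by (simp add: uncertainty_def)
      then show ?thesis using 0(3)[OF that] by (simp add: mult_left_mono)
    qed
    then show ?thesis using run_in[OF assms(3)]
      by (intro exI[of _ "Leaf (run I T x0)"]) (auto intro: sum_mono)
  qed
next
  case (Suc R)
  show ?case
  proof (cases "X = {}")
    case True
    then show ?thesis using run_in[OF assms(3)] by (intro exI[of _ "Leaf (run I T undefined)"]) auto
  next
    case False
    define W where "W = sum w Z"
    define l where "l = leaf_weight I T Z w"
    have l_le: "l x \<le> W" for x
      unfolding l_def W_def by (rule leaf_weight_le[OF assms(2) Suc.prems(2)])
    have l_pos: "0 < l x" if "x \<in> X" for x using Suc.prems(4) that by (simp add: l_def)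
    have W_pos: "0 < W" using False l_le l_pos by (meson all_not_in_conv less_le_trans)
    obtain C where C: "finite C" "fst ` C \<subseteq> cube I"
      "\<And>x y. same_leaf I T x y \<Longrightarrow> satisfies I C x = satisfies I C y"
      "W / 3 \<le> sum w {z\<in>Z. satisfies I C z}"
      "sum w {z\<in>Z. satisfies I C z} \<le> 2 * (W / 3) \<or>
       (\<forall>x y. satisfies I C x \<longrightarrow> satisfies I C y \<longrightarrow> same_leaf I T x y)"
      using heavy_node[of Z w I Y T "W / 3"] assms(2,3) Suc.prems(2) W_pos
      unfolding W_def[symmetric] by auto
    define V where "V = sum w {z\<in>Z. satisfies I C z}"
    \<comment> \<open>Bayesian updates after a passed (\<open>w1\<close>) and a failed
      (\<open>w2\<close>) test. The factor one half common to all survivors of a failed test is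
      dropped, since \<open>uncertainty\<close> is invariant under scaling.\<close>
    define w1 where "w1 z = (if satisfies I C z then w z else w z / 2)" for z
    define w2 where "w2 z = (if satisfies I C z then 0 else w z)" for z
    have split: "sum g Z = sum g {z\<in>Z. satisfies I C z} + sum g {z\<in>Z. \<not> satisfies I C z}"
      for g :: "_ \<Rightarrow> real"
      using sum.Int_Diff[OF assms(2), of g "Collect (satisfies I C)"]
      by (simp add: Int_def set_diff_eq)
    have rest: "sum w {z\<in>Z. \<not> satisfies I C z} = W - V"
      using split[of w] by (simp add: W_def V_def)
    have w1: "sum w1 Z = (W + V) / 2" "\<And>z. z \<in> Z \<Longrightarrow> 0 \<le> w1 z"
      using rest Suc.prems(2) unfolding split[of w1]
      by (auto simp: w1_def V_def sum_divide_distrib[symmetric] field_simps)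
    have w2: "sum w2 Z = W - V" "\<And>z. z \<in> Z \<Longrightarrow> 0 \<le> w2 z"
      using rest Suc.prems(2) unfolding split[of w2] by (auto simp: w2_def)
    have l1: "leaf_weight I T Z w1 x = (if satisfies I C x then l x else l x / 2)" for x
      using C(3)[of x] unfolding l_def leaf_weight_def
      by (auto simp: w1_def sum_divide_distrib intro!: sum.cong)
    have l2: "leaf_weight I T Z w2 x = (if satisfies I C x then 0 else l x)" for x
      using C(3)[of x] unfolding l_def leaf_weight_def
      by (auto simp: w2_def intro!: sum.cong sum.neutral)
    define viol where "viol x = {c. inner2 I (fst c) x \<noteq> snd c}" for x
    define h where "h S x = (if even (card (S \<inter> viol x)) then uncertainty I T Z w1 x
      else uncertainty I T Z w2 x)" for S x
    have avg: "(\<Sum>S\<in>Pow C. h S x) \<le> 2 ^ card C * (99 / 100 * uncertainty I T Z w x)"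
      if x: "x \<in> X" for x
    proof (cases "satisfies I C x")
      case True
      then have "S \<inter> viol x = {}" if "S \<in> Pow C" for S
        using that by (auto simp: viol_def satisfies_def)
      then have "(\<Sum>S\<in>Pow C. h S x) = 2 ^ card C * uncertainty I T Z w1 x"
        by (simp add: h_def card_Pow[OF C(1)])
      moreover have "V \<le> 2 * W / 3 \<or> V = l x"
      proof (rule disjE[OF C(5)])
        assume "\<forall>x y. satisfies I C x \<longrightarrow> satisfies I C y \<longrightarrow> same_leaf I T x y"
        then have "{z\<in>Z. satisfies I C z} = {z\<in>Z. same_leaf I T x z}" using True C(3) by blast
        then show ?thesis by (simp add: V_def l_def leaf_weight_def)
      qed (simp add: V_def)
      ultimately show ?thesis
        using uncertainty_step_inside[OF l_pos[OF x] l_le, of V] True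
        by (simp add: uncertainty_def w1 l1 W_def[symmetric] l_def[symmetric])
    next
      case False
      then obtain v where v: "v \<in> C" "v \<in> viol x" by (auto simp: viol_def satisfies_def)
      have lV: "l x + V \<le> W"
        unfolding l_def V_def W_def
        by (rule leaf_weight_add_le[OF assms(2) Suc.prems(2)]) (use False C(3) in auto)
      have "(\<Sum>S\<in>Pow C. h S x) =
          2 ^ card C * ((uncertainty I T Z w1 x + uncertainty I T Z w2 x) / 2)"
        unfolding h_def by (rule sum_Pow_parity[OF C(1) v])
      \<comment> \<open>Outside the node, passing leaves total \<open>(W + V) / 2\<close> and leaf
        weight \<open>l x / 2\<close>, failing leaves \<open>W - V\<close> and \<open>l x\<close>.
        The squared uncertainty thus moves by \<open>V / l x\<close> up or down.\<close>
      also have "uncertainty I T Z w1 x = sqrt ((W - l x) / l x + V / l x)"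
        using False l_pos[OF x] by (simp add: uncertainty_def w1 l1 field_simps)
      also have "uncertainty I T Z w2 x = sqrt ((W - l x) / l x - V / l x)"
        using False l_pos[OF x] by (simp add: uncertainty_def w2 l2 field_simps)
      also have "(sqrt ((W - l x) / l x + V / l x) + sqrt ((W - l x) / l x - V / l x)) / 2
          \<le> 99 / 100 * sqrt ((W - l x) / l x)"
      proof (rule sqrt_average_bound)
        have "(W - l x) / 3 / l x \<le> V / l x"
          using l_pos[OF x] C(4) by (intro divide_right_mono) (auto simp: V_def)
        then show "(W - l x) / l x / 3 \<le> V / l x" by (simp add: mult.commute)
        show "V / l x \<le> (W - l x) / l x"
          using l_pos[OF x] lV by (intro divide_right_mono) auto
      qed (use l_pos[OF x] l_le[of x] in auto)
      also have "sqrt ((W - l x) / l x) = uncertainty I T Z w x"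
        by (simp add: uncertainty_def W_def l_def)
      finally show ?thesis by simp
    qed
    \<comment> \<open>Derandomisation: some fixed combination is at least as good as the average
      one, so the tree stays deterministic.\<close>
    have "\<exists>S\<in>Pow C. (\<Sum>x\<in>X. q x * h S x) \<le> 99 / 100 * (\<Sum>x\<in>X. q x * uncertainty I T Z w x)"
    proof (rule ccontr)
      assume "\<not> ?thesis"
      then have "(\<Sum>S\<in>Pow C. 99 / 100 * (\<Sum>x\<in>X. q x * uncertainty I T Z w x))
          < (\<Sum>S\<in>Pow C. \<Sum>x\<in>X. q x * h S x)"
        using C(1) by (intro sum_strict_mono) (auto simp: not_le)
      also have "\<dots> = (\<Sum>x\<in>X. q x * (\<Sum>S\<in>Pow C. h S x))"
        by (subst sum.swap) (simp add: sum_distrib_left)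
      also have "\<dots> \<le> (\<Sum>x\<in>X. q x * (2 ^ card C * (99 / 100 * uncertainty I T Z w x)))"
        using avg Suc.prems(3) by (intro sum_mono mult_left_mono)
      also have "\<dots> = (\<Sum>S\<in>Pow C. 99 / 100 * (\<Sum>x\<in>X. q x * uncertainty I T Z w x))"
        by (simp add: card_Pow[OF C(1)] sum_distrib_left mult_ac)
      finally show False by simp
    qed
    then obtain S where S: "S \<subseteq> C"
      "(\<Sum>x\<in>X. q x * h S x) \<le> 99 / 100 * (\<Sum>x\<in>X. q x * uncertainty I T Z w x)" by auto
    obtain a b where ab: "a \<in> cube I" "\<And>x. inner2 I a x = b \<longleftrightarrow> even (card (S \<inter> viol x))"
    proof -
      have "S \<inter> viol x = {c\<in>S. inner2 I (fst c) x \<noteq> snd c}" for x by (auto simp: viol_def)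
      then show ?thesis
        using parity_combination[OF assms(1), of S] S(1) C(1,2) finite_subset that
        by (metis (no_types, lifting) image_mono order_trans)
    qed
    define X1 where "X1 = {x\<in>X. inner2 I a x = b}"
    define X2 where "X2 = {x\<in>X. inner2 I a x \<noteq> b}"
    \<comment> \<open>An input failing the test is not at the node, so its leaf keeps positive
      weight under \<open>w2\<close>, as the induction hypothesis requires.\<close>
    have X2: "\<not> satisfies I C x" if "x \<in> X2" for x
    proof
      assume "satisfies I C x"
      then have "S \<inter> viol x = {}" using S(1) by (auto simp: viol_def satisfies_def)
      then show False using that ab(2)[of x] by (simp add: X2_def)
    qed
    have splitX: "sum g X = sum g X1 + sum g X2" for g :: "_ \<Rightarrow> real"
      using sum.Int_Diff[OF Suc.prems(1), of g "{x. inner2 I a x = b}"]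
      by (simp add: Int_def set_diff_eq X1_def X2_def)
    obtain T1 where T1: "pdt_on I Y T1" "depth T1 \<le> R"
      "(\<Sum>x\<in>X1. q x * of_bool (run I T1 x \<noteq> run I T x)) \<le>
        (99 / 100) ^ R * (\<Sum>x\<in>X1. q x * uncertainty I T Z w1 x)"
    proof -
      have "finite X1" "\<And>x. x \<in> X1 \<Longrightarrow> 0 \<le> q x" using Suc.prems by (auto simp: X1_def)
      moreover have "0 < leaf_weight I T Z w1 x" if "x \<in> X1" for x
        using that l_pos[of x] by (auto simp: l1 X1_def)
      ultimately show ?thesis using Suc.IH[of X1 w1] w1(2) that by blast
    qed
    obtain T2 where T2: "pdt_on I Y T2" "depth T2 \<le> R"
      "(\<Sum>x\<in>X2. q x * of_bool (run I T2 x \<noteq> run I T x)) \<le>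
        (99 / 100) ^ R * (\<Sum>x\<in>X2. q x * uncertainty I T Z w2 x)"
    proof -
      have "finite X2" "\<And>x. x \<in> X2 \<Longrightarrow> 0 \<le> q x" using Suc.prems by (auto simp: X2_def)
      moreover have "0 < leaf_weight I T Z w2 x" if "x \<in> X2" for x
        using that l_pos[of x] X2[of x] by (auto simp: l2 X2_def)
      ultimately show ?thesis using Suc.IH[of X2 w2] w2(2) that by blast
    qed
    define T' where "T' = (if b then Query a T2 T1 else Query a T1 T2)"
    have run: "run I T' x = (if inner2 I a x = b then run I T1 x else run I T2 x)" for x
      by (auto simp: T'_def)
    have "(\<Sum>x\<in>X. q x * of_bool (run I T' x \<noteq> run I T x)) =
        (\<Sum>x\<in>X1. q x * of_bool (run I T1 x \<noteq> run I T x)) +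
        (\<Sum>x\<in>X2. q x * of_bool (run I T2 x \<noteq> run I T x))"
      unfolding splitX by (intro arg_cong2[where f = "(+)"] sum.cong) (auto simp: run X1_def X2_def)
    also have "\<dots> \<le> (99 / 100) ^ R * ((\<Sum>x\<in>X1. q x * uncertainty I T Z w1 x) +
        (\<Sum>x\<in>X2. q x * uncertainty I T Z w2 x))"
      using T1(3) T2(3) by (simp add: distrib_left)
    also have "(\<Sum>x\<in>X1. q x * uncertainty I T Z w1 x) + (\<Sum>x\<in>X2. q x * uncertainty I T Z w2 x)
        = (\<Sum>x\<in>X. q x * h S x)"
      unfolding splitX
      by (intro arg_cong2[where f = "(+)"] sum.cong) (auto simp: h_def ab(2) X1_def X2_def)
    also have "(99 / 100) ^ R * (\<Sum>x\<in>X. q x * h S x) \<le>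
        (99 / 100) ^ R * (99 / 100 * (\<Sum>x\<in>X. q x * uncertainty I T Z w x))"
      using S(2) by (intro mult_left_mono) auto
    finally have "(\<Sum>x\<in>X. q x * of_bool (run I T' x \<noteq> run I T x)) \<le>
        (99 / 100) ^ Suc R * (\<Sum>x\<in>X. q x * uncertainty I T Z w x)" by simp
    then show ?thesis
      using T1 T2 ab(1) by (intro exI[of _ T']) (auto simp: T'_def)
  qed
qed

subsection \<open>The direct sum bound\<close>

text \<open>Such a vector arises from \<open>m\<close> on \<open>I\<close> in \<open>r\<close>
  rounds, each flipping one coordinate or none, which leaves \<open>card I + 1\<close> choices per
  round.\<close>

lemma card_sparse:
  assumes "finite I"
  shows "card {z\<in>cube I. card {i\<in>I. z i \<noteq> m i} \<le> r} \<le> (card I + 1) ^ r"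
proof (induction r)
  case 0
  have "{z\<in>cube I. card {i\<in>I. z i \<noteq> m i} \<le> 0} \<subseteq> {\<lambda>i. i \<in> I \<and> m i}"
    using assms by (auto simp: cube_iff fun_eq_iff)
  then show ?case using card_mono[of "{\<lambda>i. i \<in> I \<and> m i}"] by fastforce
next
  case (Suc r)
  let ?Z = "\<lambda>r. {z\<in>cube I. card {i\<in>I. z i \<noteq> m i} \<le> r}"
  let ?h = "\<lambda>(z, c). case c of None \<Rightarrow> z | Some i \<Rightarrow> z(i := \<not> m i)"
  have fin: "finite (?Z r)" using finite_cube[OF assms] by simp
  have "?Z (Suc r) \<subseteq> ?h ` (?Z r \<times> insert None (Some ` I))"
  proof
    fix z assume z: "z \<in> ?Z (Suc r)"
    show "z \<in> ?h ` (?Z r \<times> insert None (Some ` I))"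
    proof (cases "\<exists>i\<in>I. z i \<noteq> m i")
      case True
      then obtain i where i: "i \<in> I" "z i \<noteq> m i" by blast
      have eq: "{l\<in>I. (z(i := m i)) l \<noteq> m l} = {l\<in>I. z l \<noteq> m l} - {i}" by auto
      have "card ({l\<in>I. z l \<noteq> m l} - {i}) = card {l\<in>I. z l \<noteq> m l} - 1"
        by (rule card_Diff_singleton) (use i in simp)
      moreover have "card {l\<in>I. z l \<noteq> m l} \<le> Suc r" using z by simp
      ultimately have "card {l\<in>I. (z(i := m i)) l \<noteq> m l} \<le> r" unfolding eq by linarith
      then have "z(i := m i) \<in> ?Z r" using z i by (auto simp: cube_iff)
      moreover have "m i = (\<not> z i)" using i(2) by blast
      then have "z = ?h (z(i := m i), Some i)" by simp
      ultimately show ?thesis using i(1) by blast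
    next
      case False
      then have "{i\<in>I. z i \<noteq> m i} = {}" by blast
      then have "z \<in> ?Z r" using z by (simp only: mem_Collect_eq card.empty) simp
      moreover have "z = ?h (z, None)" by simp
      ultimately show ?thesis by blast
    qed
  qed
  then have "card (?Z (Suc r)) \<le> card (?h ` (?Z r \<times> insert None (Some ` I)))"
    using fin assms by (intro card_mono) auto
  also have "\<dots> \<le> card (?Z r \<times> insert None (Some ` I))"
    using fin assms by (intro card_image_le) auto
  also have "\<dots> = card (?Z r) * (card I + 1)"
    using assms by (auto simp: card_cartesian_product card_insert_if card_image)
  also have "\<dots> \<le> (card I + 1) ^ r * (card I + 1)" using Suc.IH by (rule mult_le_mono1)
  finally show ?case by (simp add: mult.commute)
qed

lemma leaf_dist_attained:
  assumes "x \<in> cube I"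
  shows "\<exists>z\<in>cube I. same_leaf I T x z \<and> card {i\<in>I. z i \<noteq> m i} = leaf_dist I T m x"
proof -
  have "\<exists>d. \<exists>z\<in>cube I. same_leaf I T x z \<and> card {i\<in>I. z i \<noteq> m i} = d"
    by (intro exI[of _ "card {i\<in>I. x i \<noteq> m i}"] bexI[OF _ assms]) simp
  then show ?thesis unfolding leaf_dist_def by (rule LeastI_ex)
qed

text \<open>The search starts with weight one on every vector within distance \<open>r\<close> of
  \<open>m\<close>. Inputs whose leaf is that close have leaf weight at least one, so their initial
  uncertainty is at most the root of the number of candidates. For all other inputs the term
  \<open>leaf_dist / r\<close> is at least one and pays for any error. The depth of \<open>S\<close>
  does not enter.\<close>

lemma sparse_leaf_search:
  fixes \<mu> :: "('i \<Rightarrow> bool) pmf" and r :: nat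
  assumes "finite I" "pdt_on I Y S" "set_pmf \<mu> \<subseteq> cube I" "0 < r"
    and \<eta>: "(99 / 100) ^ R * sqrt (real ((card I + 1) ^ r)) \<le> \<eta>"
  shows "\<exists>T. pdt_on I Y T \<and> depth T \<le> R \<and> measure_pmf.prob \<mu> {x. run I T x \<noteq> g x} \<le>
    measure_pmf.expectation \<mu> (\<lambda>x. of_bool (run I S x \<noteq> g x) + real (leaf_dist I S m x) / real r) + \<eta>"
proof -
  have fin: "finite (set_pmf \<mu>)" using finite_subset[OF assms(3) finite_cube[OF assms(1)]] .
  note int = integrable_measure_pmf_finite[OF fin]
  define Z where "Z = {z\<in>cube I. card {i\<in>I. z i \<noteq> m i} \<le> r}"
  define X where "X = {x\<in>set_pmf \<mu>. leaf_dist I S m x \<le> r}"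
  have fin_Z: "finite Z" using finite_cube[OF assms(1)] by (simp add: Z_def)
  have fin_X: "finite X" using fin by (simp add: X_def)
  have lw: "1 \<le> leaf_weight I S Z (\<lambda>_. 1) x" if "x \<in> X" for x
  proof -
    have "x \<in> cube I" using that assms(3) by (auto simp: X_def)
    then obtain z where "z \<in> cube I" "same_leaf I S x z" "card {i\<in>I. z i \<noteq> m i} = leaf_dist I S m x"
      using leaf_dist_attained by blast
    then have "z \<in> {z\<in>Z. same_leaf I S x z}" using that by (simp add: Z_def X_def)
    then have "card {z\<in>Z. same_leaf I S x z} \<noteq> 0" using fin_Z by auto
    then show ?thesis by (simp add: leaf_weight_def)
  qed
  have "0 < leaf_weight I S Z (\<lambda>_. 1) x" if "x \<in> X" for x
    using lw[OF that] by linarith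
  then have "\<exists>T. pdt_on I Y T \<and> depth T \<le> R \<and>
    (\<Sum>x\<in>X. pmf \<mu> x * of_bool (run I T x \<noteq> run I S x)) \<le>
      (99 / 100) ^ R * (\<Sum>x\<in>X. pmf \<mu> x * uncertainty I S Z (\<lambda>_. 1) x)"
    by (intro leaf_search[OF assms(1) fin_Z assms(2) fin_X]) simp_all
  then obtain T where T: "pdt_on I Y T" "depth T \<le> R"
    "(\<Sum>x\<in>X. pmf \<mu> x * of_bool (run I T x \<noteq> run I S x)) \<le>
      (99 / 100) ^ R * (\<Sum>x\<in>X. pmf \<mu> x * uncertainty I S Z (\<lambda>_. 1) x)"
    by blast
  have unc: "uncertainty I S Z (\<lambda>_. 1) x \<le> sqrt (real ((card I + 1) ^ r))" if "x \<in> X" for x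
  proof -
    let ?l = "leaf_weight I S Z (\<lambda>_. 1) x"
    have "(real (card Z) - ?l) / ?l \<le> (real (card Z) - ?l) / 1"
      using lw[OF that] leaf_weight_le[OF fin_Z, of "\<lambda>_. 1" I S x]
      by (intro divide_left_mono) auto
    also have "\<dots> \<le> real (card Z)" using lw[OF that] by simp
    also have "\<dots> \<le> real ((card I + 1) ^ r)"
      unfolding Z_def using card_sparse[OF assms(1)] by (intro of_nat_mono)
    finally show ?thesis unfolding uncertainty_def by simp
  qed
  have "(\<Sum>x\<in>X. pmf \<mu> x * uncertainty I S Z (\<lambda>_. 1) x) \<le>
      (\<Sum>x\<in>X. pmf \<mu> x * sqrt (real ((card I + 1) ^ r)))"
    using unc by (intro sum_mono mult_left_mono) auto
  also have "\<dots> = measure_pmf.prob \<mu> X * sqrt (real ((card I + 1) ^ r))"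
    using fin_X by (simp add: measure_measure_pmf_finite sum_distrib_right)
  also have "\<dots> \<le> 1 * sqrt (real ((card I + 1) ^ r))"
    by (intro mult_right_mono) auto
  finally have "(99 / 100) ^ R * (\<Sum>x\<in>X. pmf \<mu> x * uncertainty I S Z (\<lambda>_. 1) x) \<le>
      (99 / 100) ^ R * sqrt (real ((card I + 1) ^ r))"
    by (intro mult_left_mono) auto
  then have err: "(\<Sum>x\<in>X. pmf \<mu> x * of_bool (run I T x \<noteq> run I S x)) \<le> \<eta>"
    using T(3) \<eta> by linarith
  let ?B = "\<lambda>x. of_bool (run I S x \<noteq> g x) + real (leaf_dist I S m x) / real r"
  let ?A = "\<lambda>x. of_bool (x \<in> X \<and> run I T x \<noteq> run I S x) :: real"
  have "measure_pmf.prob \<mu> {x. run I T x \<noteq> g x} =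
      measure_pmf.expectation \<mu> (indicator {x. run I T x \<noteq> g x})" by simp
  also have "\<dots> \<le> measure_pmf.expectation \<mu> (\<lambda>x. ?B x + ?A x)"
  proof (rule integral_mono_AE[OF int int], unfold AE_measure_pmf_iff, intro ballI)
    fix x assume x: "x \<in> set_pmf \<mu>"
    show "indicator {x. run I T x \<noteq> g x} x \<le> ?B x + ?A x"
    proof (cases "x \<in> X")
      case True
      then show ?thesis by (auto simp: indicator_def)
    next
      case False
      then have "1 \<le> real (leaf_dist I S m x) / real r" using x assms(4) by (simp add: X_def)
      then show ?thesis by (auto simp: indicator_def)
    qed
  qed
  also have "\<dots> = measure_pmf.expectation \<mu> ?B + measure_pmf.expectation \<mu> ?A"
    by (rule Bochner_Integration.integral_add) (rule int)+
  also have "measure_pmf.expectation \<mu> ?A = (\<Sum>x\<in>X. pmf \<mu> x * of_bool (run I T x \<noteq> run I S x))"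
    by (subst integral_measure_pmf[OF fin_X]) (auto intro!: sum.cong)
  finally show ?thesis using T(1,2) err by (intro exI[of _ T]) auto
qed

section \<open>Optimal trees exist, and elementary bounds on the complexity\<close>

lemma inner2_unit:
  assumes "finite I" "i \<in> I"
  shows "inner2 I (\<lambda>l. l = i) x = x i"
proof -
  have "inner2 (I - {i}) (\<lambda>l. l = i) x = False"
    unfolding inner2_def by (subst sum.neutral) auto
  then show ?thesis using inner2_update[OF assms, of "\<lambda>l. l = i" x "x i"] by simp
qed

lemma exact_pdt:
  assumes "finite I" "\<And>x. x \<in> cube I \<Longrightarrow> g x \<in> Y"
  shows "\<exists>T. pdt_on I Y T \<and> (\<forall>x\<in>cube I. run I T x = g x)"
proof -
  \<comment> \<open>Coordinates are read one at a time; bits outside \<open>J\<close> count as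
    false, and \<open>g\<close> is left arbitrary so that a bit already read can be fixed inside
    it.\<close>
  have "\<exists>T. pdt_on I Y T \<and> (\<forall>x. run I T x = g (\<lambda>l. l \<in> J \<and> x l))"
    if "J \<subseteq> I" for J
    using finite_subset[OF that assms(1)] that assms(2)
  proof (induction J arbitrary: g)
    case empty
    then show ?case by (intro exI[of _ "Leaf (g (\<lambda>_. False))"]) (auto simp: cube_iff)
  next
    case (insert i J)
    have "\<exists>T. pdt_on I Y T \<and> (\<forall>x. run I T x = g ((\<lambda>l. l \<in> J \<and> x l)(i := b)))" for b
      using insert.prems by (intro insert.IH) (auto simp: cube_iff)
    then obtain T where T: "\<And>b. pdt_on I Y (T b)"
      "\<And>b x. run I (T b) x = g ((\<lambda>l. l \<in> J \<and> x l)(i := b))" by metis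
    let ?Q = "Query (\<lambda>l. l = i) (T False) (T True)"
    have "run I ?Q x = g (\<lambda>l. l \<in> insert i J \<and> x l)" for x
    proof -
      have "run I ?Q x = run I (T (x i)) x"
        using insert.prems inner2_unit[OF assms(1), of i] by (cases "x i") simp_all
      also have "\<dots> = g (\<lambda>l. l \<in> insert i J \<and> x l)"
        unfolding T(2) by (rule arg_cong[where f = g]) (auto simp: fun_eq_iff)
      finally show ?thesis .
    qed
    then show ?case using T(1) insert.prems(1) by (intro exI[of _ ?Q]) (auto simp: cube_iff)
  qed
  from this[of I] obtain T where T: "pdt_on I Y T" "\<And>x. run I T x = g (\<lambda>l. l \<in> I \<and> x l)" by auto
  have "(\<lambda>l. l \<in> I \<and> x l) = x" if "x \<in> cube I" for x using that by (auto simp: cube_iff)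
  then show ?thesis using T by (intro exI[of _ T]) auto
qed

lemma pdt_complexity_le:
  assumes "pdt_on I Y T" "measure_pmf.prob \<nu> {x. run I T x \<noteq> g x} \<le> \<epsilon>"
  shows "pdt_complexity I Y \<epsilon> g \<nu> \<le> depth T"
  unfolding pdt_complexity_def using assms by (intro Least_le) auto

lemma pdt_complexity_attained:
  assumes "finite I" "\<And>x. x \<in> cube I \<Longrightarrow> g x \<in> Y" "set_pmf \<nu> \<subseteq> cube I" "0 \<le> \<epsilon>"
  shows "\<exists>T. pdt_on I Y T \<and> depth T = pdt_complexity I Y \<epsilon> g \<nu> \<and>
    measure_pmf.prob \<nu> {x. run I T x \<noteq> g x} \<le> \<epsilon>"
proof -
  obtain T where T: "pdt_on I Y T" "\<forall>x\<in>cube I. run I T x = g x"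
    using exact_pdt[OF assms(1), of g Y] assms(2) by auto
  have "measure_pmf.prob \<nu> {x. run I T x \<noteq> g x} = 0"
    using T(2) assms(3) by (subst measure_pmf_zero_iff) auto
  then show ?thesis
    unfolding pdt_complexity_def using T(1) assms(4)
    by (intro LeastI_ex[of "\<lambda>d. \<exists>T. pdt_on I Y T \<and> depth T = d \<and>
        measure_pmf.prob \<nu> {x. run I T x \<noteq> g x} \<le> \<epsilon>"]) auto
qed

text \<open>The better of the two constant guesses errs with probability at most one half. This
  reduces the main bound to errors below one half.\<close>

lemma pdt_complexity_bool_half:
  fixes f :: "('i \<Rightarrow> bool) \<Rightarrow> bool"
  assumes "1 / 2 \<le> \<epsilon>"
  shows "pdt_complexity I UNIV \<epsilon> f \<mu> = 0"
proof -
  have "measure_pmf.prob \<mu> {x. f x} + measure_pmf.prob \<mu> {x. \<not> f x} = 1"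
    using measure_pmf.prob_compl[of "{x. f x}" \<mu>] by (simp add: Collect_neg_eq Compl_eq_Diff_UNIV)
  then have "\<exists>b. measure_pmf.prob \<mu> {x. b \<noteq> f x} \<le> \<epsilon>"
    using assms by (cases "measure_pmf.prob \<mu> {x. f x} \<le> 1 / 2")
      (auto intro: exI[of _ False] exI[of _ True])
  then obtain b where "measure_pmf.prob \<mu> {x. b \<noteq> f x} \<le> \<epsilon>" by blast
  then show ?thesis using pdt_complexity_le[of I UNIV "Leaf b" \<mu> f \<epsilon>] by simp
qed

lemma pdt_on_UNIV: "pdt_on I Y T \<Longrightarrow> pdt_on I UNIV T"
  by (induction T) auto

lemma set_dist_power_subset:
  assumes "set_pmf \<mu> \<subseteq> cube {..<n}"
  shows "set_pmf (dist_power k \<mu>) \<subseteq> cube ({..<k} \<times> {..<n})"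
proof
  fix x assume "x \<in> set_pmf (dist_power k \<mu>)"
  then obtain X where X: "x = (\<lambda>(j, i). X j i)" "X \<in> PiE_dflt {..<k} (\<lambda>_. False) (\<lambda>_. set_pmf \<mu>)"
    by (auto simp: dist_power_def set_Pi_pmf o_def)
  have "\<not> X j i" if "\<not> (j < k \<and> i < n)" for j i
    using that X(2) assms by (cases "j < k") (auto simp: PiE_dflt_def cube_iff)
  then show "x \<in> cube ({..<k} \<times> {..<n})" by (auto simp: X(1) cube_iff)
qed

text \<open>A single-block tree of potential below \<open>\<epsilon> + \<delta> / 2\<close> would
  give, by the sparse search, a tree of depth at most \<open>R\<close> and error at most
  \<open>\<epsilon> + \<delta>\<close>. So \<open>k\<close> blocks have potential at least
  \<open>k * (\<epsilon> + \<delta> / 2)\<close>. Wrong bits occur only when the whole output is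
  wrong and number at most \<open>k\<close>, so they account for \<open>k * \<epsilon>\<close>;
  queries at \<open>1 / r\<close> each must pay the rest.\<close>

lemma product_power_lower_bound:
  fixes f :: "(nat \<Rightarrow> bool) \<Rightarrow> bool" and r R :: nat
  assumes "product_distribution n \<mu>" "0 \<le> \<epsilon>" "0 < r"
    and \<delta>: "(99 / 100) ^ R * sqrt (real ((n + 1) ^ r)) \<le> \<delta> / 2"
    and R: "R < pdt_complexity {..<n} UNIV (\<epsilon> + \<delta>) f \<mu>"
  shows "real k * real r * \<delta> / 2 \<le>
    real (pdt_complexity ({..<k} \<times> {..<n}) (cube {..<k}) \<epsilon> (fun_power k f) (dist_power k \<mu>))"
proof -
  let ?I = "{..<k} \<times> {..<n}"
  obtain p where p: "\<forall>i\<in>{..<n}. 0 \<le> p i \<and> p i \<le> 1"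
    and \<mu>: "\<mu> = Pi_pmf {..<n} False (\<lambda>i. bernoulli_pmf (p i))"
    using assms(1) by (auto simp: product_distribution_def)
  have supp: "set_pmf \<mu> \<subseteq> cube {..<n}" unfolding \<mu> by (rule set_Pi_pmf_cube) simp
  have fin: "finite (set_pmf \<mu>)" by (rule finite_subset[OF supp finite_cube]) simp
  obtain m \<Lambda> where m: "m \<in> cube {..<n}"
    and \<Lambda>: "\<And>\<rho>. 0 \<le> \<Lambda> \<rho>" "(\<Sum>\<rho>\<in>Pow {..<n}. \<Lambda> \<rho>) = (1::real)"
    and mix: "\<And>G::_ \<Rightarrow> real. measure_pmf.expectation \<mu> G =
      (\<Sum>\<rho>\<in>Pow {..<n}. \<Lambda> \<rho> * ((\<Sum>u\<in>cube \<rho>. G (override_on m u \<rho>)) / 2 ^ card \<rho>))"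
    using bernoulli_product_mixture[OF finite_lessThan p] unfolding \<mu> by blast
  have single: "\<epsilon> + \<delta> / 2 \<le> measure_pmf.expectation \<mu>
      (\<lambda>y. of_bool (run {..<n} S y \<noteq> f y) + real (leaf_dist {..<n} S m y) / real r)"
    if S: "pdt_on {..<n} UNIV S" for S :: "(nat, bool) pdt"
  proof (rule ccontr)
    assume "\<not> ?thesis"
    moreover obtain T where T: "pdt_on {..<n} UNIV T" "depth T \<le> R"
      "measure_pmf.prob \<mu> {x. run {..<n} T x \<noteq> f x} \<le> measure_pmf.expectation \<mu>
        (\<lambda>y. of_bool (run {..<n} S y \<noteq> f y) + real (leaf_dist {..<n} S m y) / real r) + \<delta> / 2"
      using sparse_leaf_search[OF finite_lessThan S supp assms(3), of R "\<delta> / 2"] \<delta>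
      unfolding card_lessThan by blast
    ultimately have "measure_pmf.prob \<mu> {x. run {..<n} T x \<noteq> f x} \<le> \<epsilon> + \<delta>" by linarith
    then show False using pdt_complexity_le[OF T(1)] T(2) R by fastforce
  qed
  have supp_D: "set_pmf (dist_power k \<mu>) \<subseteq> cube ?I" by (rule set_dist_power_subset[OF supp])
  obtain T where T: "pdt_on ?I (cube {..<k}) T"
    "depth T = pdt_complexity ?I (cube {..<k}) \<epsilon> (fun_power k f) (dist_power k \<mu>)"
    "measure_pmf.prob (dist_power k \<mu>) {x. run ?I T x \<noteq> fun_power k f x} \<le> \<epsilon>"
    using pdt_complexity_attained[OF _ _ supp_D assms(2), of "fun_power k f" "cube {..<k}"]
    by (auto simp: fun_power_def cube_iff)
  note int = integrable_measure_pmf_finite[OF finite_set_dist_power[OF fin, of k]]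
  have "real k * (\<epsilon> + \<delta> / 2) \<le> measure_pmf.expectation (dist_power k \<mu>)
      (\<lambda>x. (\<Sum>i<k. of_bool (run ?I T x i \<noteq> f (\<lambda>l. x (i, l)))) + real (path_length ?I T x) / real r)"
    by (rule potential_lower_bound[OF fin m \<Lambda> mix _ single pdt_on_UNIV[OF T(1)]])
      (use assms(3) in auto)
  also have "\<dots> \<le> measure_pmf.expectation (dist_power k \<mu>)
      (\<lambda>x. real k * indicator {x. run ?I T x \<noteq> fun_power k f x} x + real (depth T) / real r)"
  proof (rule integral_mono[OF int int])
    fix x
    have "(\<Sum>i<k. of_bool (run ?I T x i \<noteq> f (\<lambda>l. x (i, l)))) \<le>
        (\<Sum>i<k. indicator {x. run ?I T x \<noteq> fun_power k f x} x :: real)"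
      by (rule sum_mono) (auto simp: indicator_def fun_power_def)
    moreover have "real (path_length ?I T x) / real r \<le> real (depth T) / real r"
      using path_length_le_depth[of ?I T x] by (intro divide_right_mono) auto
    ultimately show "(\<Sum>i<k. of_bool (run ?I T x i \<noteq> f (\<lambda>l. x (i, l)))) +
        real (path_length ?I T x) / real r \<le>
        real k * indicator {x. run ?I T x \<noteq> fun_power k f x} x + real (depth T) / real r"
      by simp
  qed
  also have "\<dots> = real k * measure_pmf.prob (dist_power k \<mu>) {x. run ?I T x \<noteq> fun_power k f x} +
      real (depth T) / real r"
    by (simp add: int)
  also have "\<dots> \<le> real k * \<epsilon> + real (depth T) / real r"
    using T(3) by (simp add: mult_left_mono)
  finally have "real k * \<delta> / 2 \<le> real (depth T) / real r" by (simp add: algebra_simps)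
  then show ?thesis
    using assms(3) unfolding T(2) by (simp add: field_simps)
qed

text \<open>Seventy rounds halve the error because \<open>0.99^70 \<le> 1 / 2\<close>. With
  \<open>q = n / \<delta>\<close>, the bound \<open>\<delta> < 1 / 2\<close> makes \<open>q\<close>
  at least \<open>n + 1\<close>, \<open>1 / \<delta>\<close> and \<open>2\<close>, so
  \<open>q ^ (r + 2)\<close>, hence \<open>q ^ (3 * r)\<close>, covers the candidates and the factor
  \<open>2 / \<delta>\<close>.\<close>

lemma search_rounds_suffice:
  fixes n r :: nat and \<delta> :: real
  assumes "1 \<le> n" "0 < r" "0 < \<delta>" "\<delta> < 1 / 2"
    and R: "R = 70 * nat \<lceil>3 * real r * log 2 (real n / \<delta>)\<rceil>"
  shows "(99 / 100) ^ R * sqrt (real ((n + 1) ^ r)) \<le> \<delta> / 2"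
proof -
  define q where "q = real n / \<delta>"
  define K where "K = nat \<lceil>3 * real r * log 2 q\<rceil>"
  have qn: "real (n + 1) \<le> q" and q\<delta>: "1 / \<delta> \<le> q" and q2: "2 \<le> q"
  proof -
    have "2 * real n \<le> q" "real n * (1 / \<delta>) = q"
      using assms by (simp_all add: q_def field_simps)
    moreover have "1 / \<delta> \<le> real n * (1 / \<delta>)"
      using assms mult_right_mono[of 1 "real n" "1 / \<delta>"] by simp
    ultimately show "real (n + 1) \<le> q" "1 / \<delta> \<le> q" "2 \<le> q" using assms(1) by auto
  qed
  have "q ^ (3 * r) = 2 powr (3 * real r * log 2 q)"
  proof -
    have "2 powr (3 * real r * log 2 q) = (2 powr log 2 q) powr real (3 * r)"
      by (simp add: powr_powr mult.commute)
    also have "\<dots> = q ^ (3 * r)" using q2 by (simp add: powr_realpow del: of_nat_mult)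
    finally show ?thesis ..
  qed
  also have "\<dots> \<le> 2 powr real K"
    unfolding K_def by (intro powr_mono) (auto intro: real_nat_ceiling_ge)
  also have "\<dots> = 2 ^ K" by (simp add: powr_realpow)
  finally have qK: "q ^ (3 * r) \<le> 2 ^ K" .
  have "sqrt (real ((n + 1) ^ r)) * (2 / \<delta>) \<le> q ^ r * q ^ 2"
  proof (rule mult_mono)
    have "real ((n + 1) ^ r) \<le> q ^ r"
      unfolding of_nat_power using qn by (intro power_mono) auto
    also have "\<dots> \<le> (q ^ r)\<^sup>2"
      using q2 by (simp add: power2_eq_square mult_le_cancel_left1)
    finally show "sqrt (real ((n + 1) ^ r)) \<le> q ^ r"
      using q2 by (intro real_le_lsqrt) auto
    show "2 / \<delta> \<le> q ^ 2"
      using mult_mono[OF q2 q\<delta>] q2 assms(3) by (simp add: power2_eq_square)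
  qed (use q2 assms(3) in auto)
  also have "\<dots> = q ^ (r + 2)" by (simp only: power_add)
  also have "\<dots> \<le> q ^ (3 * r)" using q2 assms(2) by (intro power_increasing) auto
  finally have *: "sqrt (real ((n + 1) ^ r)) * (2 / \<delta>) \<le> 2 ^ K" using qK by linarith
  have "(99 / 100 :: real) ^ R = ((99 / 100) ^ 70) ^ K"
    by (simp add: R K_def q_def power_mult)
  also have "\<dots> \<le> (1 / 2) ^ K"
    by (intro power_mono) (simp_all add: power_divide)
  finally have "(99 / 100) ^ R * sqrt (real ((n + 1) ^ r)) \<le> (1 / 2) ^ K * sqrt (real ((n + 1) ^ r))"
    by (intro mult_right_mono) auto
  also have "\<dots> \<le> \<delta> / 2"
    using * assms(3) by (simp add: power_divide field_simps)
  finally show ?thesis .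
qed

theorem theorem5:
  "\<exists>C>0::real. \<exists>c>0::real.
     \<forall>(n::nat) (k::nat) (f :: (nat \<Rightarrow> bool) \<Rightarrow> bool) (\<mu> :: (nat \<Rightarrow> bool) pmf) (\<epsilon>::real) (\<delta>::real).
       n \<ge> 1 \<longrightarrow> k \<ge> 1 \<longrightarrow> product_distribution n \<mu> \<longrightarrow> \<epsilon> \<ge> 0 \<longrightarrow> 0 < \<delta> \<longrightarrow> \<delta> < real n \<longrightarrow>
       real (pdt_complexity ({..<k} \<times> {..<n}) (cube {..<k}) \<epsilon> (fun_power k f) (dist_power k \<mu>))
         \<ge> c * (real k * \<delta> / log 2 (real n / \<delta>)) *
             (real (pdt_complexity {..<n} UNIV (\<epsilon> + \<delta>) f \<mu>) - C * log 2 (real n / \<delta>))"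
proof (rule exI[of _ 300], rule conjI, simp, rule exI[of _ "1 / 1200"], rule conjI, simp, intro allI impI)
  fix n k :: nat and f :: "(nat \<Rightarrow> bool) \<Rightarrow> bool" and \<mu> :: "(nat \<Rightarrow> bool) pmf" and \<epsilon> \<delta> :: real
  assume n: "1 \<le> n" and k: "1 \<le> k" and \<mu>: "product_distribution n \<mu>"
    and \<epsilon>: "0 \<le> \<epsilon>" and \<delta>: "0 < \<delta>" "\<delta> < real n"
  define L where "L = log 2 (real n / \<delta>)"
  define D where "D = pdt_complexity {..<n} UNIV (\<epsilon> + \<delta>) f \<mu>"
  define Dk where "Dk = pdt_complexity ({..<k} \<times> {..<n}) (cube {..<k}) \<epsilon> (fun_power k f) (dist_power k \<mu>)"
  have L_pos: "0 < L" using \<delta> by (simp add: L_def)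
  have "1 / 1200 * (real k * \<delta> / L) * (real D - 300 * L) \<le> real Dk"
  proof (cases "real D \<le> 300 * L")
    case True
    then have "1 / 1200 * (real k * \<delta> / L) * (real D - 300 * L) \<le> 0"
      using L_pos \<delta>(1) by (intro mult_nonneg_nonpos) auto
    then show ?thesis by (rule order_trans) simp
  next
    case False
    \<comment> \<open>Positive complexity excludes \<open>\<epsilon> + \<delta> \<ge> 1 / 2\<close>,
      which sharpens \<open>\<delta> < n\<close> to \<open>\<delta> < 1 / 2\<close>.\<close>
    then have D_pos: "0 < D" using L_pos by (cases "D = 0") auto
    then have \<delta>_half: "\<delta> < 1 / 2"
      using pdt_complexity_bool_half[of "\<epsilon> + \<delta>" "{..<n}" f \<mu>] \<epsilon> unfolding D_def by force
    have "2 \<le> real n / \<delta>" using n \<delta>(1) \<delta>_half by (simp add: field_simps)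
    then have L1: "1 \<le> L" using \<delta> by (simp add: L_def le_log_iff)
    \<comment> \<open>The radius is the largest one the search can afford:
      \<open>R \<le> 210 * r * L + 70 \<le> 280 * r * L\<close>, below
      \<open>300 * s * L = D\<close>. Since \<open>s > 1\<close>, rounding down loses at most a
      factor two, and \<open>1200 = 4 * 300\<close> combines this with the half from
      \<open>\<delta> / 2\<close>.\<close>
    define s where "s = real D / (300 * L)"
    define r where "r = nat \<lfloor>s\<rfloor>"
    have s1: "1 < s" using False L_pos by (simp add: s_def field_simps)
    then have "s < real r + 1" and r: "1 \<le> r" "real r \<le> s"
      unfolding r_def by linarith+
    then have r2: "s \<le> 2 * real r" by linarith
    define R where "R = 70 * nat \<lceil>3 * real r * L\<rceil>"
    have rL: "1 \<le> real r * L" using r(1) L1 mult_mono[of 1 "real r" 1 L] by simp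
    have "real (nat \<lceil>3 * real r * L\<rceil>) \<le> 3 * real r * L + 1"
      using rL by linarith
    then have "real R \<le> 280 * (real r * L)"
      unfolding R_def using rL by (simp only: of_nat_mult of_nat_numeral)
    also have "\<dots> < 300 * (s * L)"
      using rL mult_right_mono[OF r(2) less_imp_le[OF L_pos]] by linarith
    also have "\<dots> = real D" using L_pos by (simp add: s_def)
    finally have "R < D" by simp
    moreover have "(99 / 100) ^ R * sqrt (real ((n + 1) ^ r)) \<le> \<delta> / 2"
      using n r(1) \<delta>(1) \<delta>_half by (intro search_rounds_suffice) (auto simp: R_def L_def)
    ultimately have "real k * real r * \<delta> / 2 \<le> real Dk"
      unfolding D_def Dk_def using r(1)
      by (intro product_power_lower_bound[OF \<mu> \<epsilon>, of r R]) auto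
    moreover have "1 / 1200 * (real k * \<delta> / L) * (real D - 300 * L) \<le> 1 / 1200 * (real k * \<delta> / L) * real D"
      using L_pos \<delta>(1) by (intro mult_left_mono) auto
    moreover have "1 / 1200 * (real k * \<delta> / L) * real D = real k * \<delta> / 4 * s"
      using L_pos by (simp add: s_def)
    moreover have "real k * \<delta> / 4 * s \<le> real k * \<delta> / 4 * (2 * real r)"
      using r2 \<delta>(1) by (intro mult_left_mono) auto
    ultimately show ?thesis by (simp add: mult_ac)
  qed
  then show "1 / 1200 * (real k * \<delta> / log 2 (real n / \<delta>)) *
      (real (pdt_complexity {..<n} UNIV (\<epsilon> + \<delta>) f \<mu>) - 300 * log 2 (real n / \<delta>))
      \<le> real (pdt_complexity ({..<k} \<times> {..<n}) (cube {..<k}) \<epsilon> (fun_power k f) (dist_power k \<mu>))"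
    unfolding L_def D_def Dk_def .
qed

end
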